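(* Assume $\operatorname{char}\mathbb F\neq 2,3$. Let $A$ be a primitive axial algebra of Jordan type $\tfrac12$ which is a Jordan algebra of Clifford type, and let $\mathcal A$ be a closed set of $\tfrac12$-axes generating $A$ such that $A$ is a $3$-transposition algebra with respect to $\mathcal A$. Assume that $D=\{\tau(a)\mid a\in\mathcal A,\ \tau(a)\ne\mathrm{id}\}$ is a conjugacy class of $G=\langle D\rangle$. Then $D$ is of $ADE$-type; that is, $D$ is of symplectic type and $G$ has no subgroup $H$ with $H=\langle D\cap H\rangle$ isomorphic to a central quotient of $\mathrm{Weyl}_2(\tilde D_4)$.
   Context: $\mathbb F$ is a field. For a commutative $\mathbb F$-algebra $A$ and $a\in A$, $\lambda\in\mathbb F$, put $A_\lambda(a)=\{x: xa=\lambda x\}$. A $\tfrac12$-axis is an idempotent $a$ with $A=A_1(a)\oplus A_0(a)\oplus A_{1/2}(a)$, $A_1(a)=\mathbb F a$, and with $A_\pm$ defined by $A_+(a)=A_1(a)\oplus A_0(a)$, $A_-(a)=A_{1/2}(a)$, satisfying $A_+A_+\subseteq A_+$, $A_+A_-\subseteq A_-$, $A_-A_-\subseteq A_+$, $A_0(a)A_0(a)\subseteq A_0(a)$. A primitive axial algebra of Jordan type $\tfrac12$ is a commutative algebra generated by $\tfrac12$-axes. The Miyamoto involution $\tau(a)$ is the automorphism acting as $1$ on $A_+(a)$ and $-1$ on $A_-(a)$. A set $\mathcal A$ of axes is closed if $a^{\tau(b)}\in\mathcal A$ for all $a,b\in\mathcal A$. $A$ is a $3$-transposition algebra with respect to a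 closed generating set $\mathcal A$ if every product of two elements of $D=\{\tau(a)\mid a\in\mathcal A,\tau(a)\ne\mathrm{id}\}$ has order $1$, $2$ or $3$. A Jordan algebra of Clifford type is an algebra isomorphic to $J(V,B)=\mathbb F\mathbf e\oplus V$ ($V$ a vector space with symmetric bilinear form $B$) with product $(\alpha\mathbf e+u)(\beta\mathbf e+v)=(\alpha\beta+B(u,v))\mathbf e+\alpha v+\beta u$. A normal generating set $D$ of $3$-transpositions of a group $G$ (involutions with $|st|\in\{1,2,3\}$ for all $s,t\in D$) is of symplectic type if for all $d,e,f\in D$ with $\langle e,f\rangle\cong S_3$, $d$ commutes with at least one of $e,f,efe$. $\mathrm{Weyl}_2(\tilde D_4)$ is the quotient of the affine Weyl group $\mathrm{Weyl}(\tilde D_4)\cong\Lambda\rtimes\mathrm{Weyl}(D_4)$ ($\Lambda$ the $D_4$ root lattice) by $2\Lambda$, so $\mathrm{Weyl}_2(\tilde D_4)\cong 2^4{:}\mathrm{Weyl}(D_4)$. A central quotient of a group is its quotient by a central subgroup. *)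

theory Defs
  imports "HOL-Analysis.Analysis" "HOL-Algebra.Algebra"
begin

text \<open>An algebra is the whole type 'a, with scalar multiplication sc over the
  field 'k and a product mu.\<close>

definition comm_algebra :: "('k::field \<Rightarrow> 'a::ab_group_add \<Rightarrow> 'a) \<Rightarrow> ('a \<Rightarrow> 'a \<Rightarrow> 'a) \<Rightarrow> bool" where
  "comm_algebra sc mu \<longleftrightarrow>
     Vector_Spaces.vector_space sc \<and>
     (\<forall>x y. mu x y = mu y x) \<and>
     (\<forall>x y z. mu (x + y) z = mu x z + mu y z) \<and>
     (\<forall>c x y. mu (sc c x) y = sc c (mu x y))"

definition eigsp :: "('k::field \<Rightarrow> 'a::ab_group_add \<Rightarrow> 'a) \<Rightarrow> ('a \<Rightarrow> 'a \<Rightarrow> 'a) \<Rightarrow> 'a \<Rightarrow> 'k \<Rightarrow> 'a set" where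
  "eigsp sc mu a l = {x. mu x a = sc l x}"

definition Aplus :: "('k::field \<Rightarrow> 'a::ab_group_add \<Rightarrow> 'a) \<Rightarrow> ('a \<Rightarrow> 'a \<Rightarrow> 'a) \<Rightarrow> 'a \<Rightarrow> 'a set" where
  "Aplus sc mu a = {x + y | x y. x \<in> eigsp sc mu a 1 \<and> y \<in> eigsp sc mu a 0}"

definition Aminus :: "('k::field \<Rightarrow> 'a::ab_group_add \<Rightarrow> 'a) \<Rightarrow> ('a \<Rightarrow> 'a \<Rightarrow> 'a) \<Rightarrow> 'a \<Rightarrow> 'a set" where
  "Aminus sc mu a = eigsp sc mu a (1/2)"

definition half_axis :: "('k::field \<Rightarrow> 'a::ab_group_add \<Rightarrow> 'a) \<Rightarrow> ('a \<Rightarrow> 'a \<Rightarrow> 'a) \<Rightarrow> 'a \<Rightarrow> bool" where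
  "half_axis sc mu a \<longleftrightarrow>
     mu a a = a \<and>
     (\<forall>x. \<exists>x1 x0 xh. x = x1 + x0 + xh \<and> x1 \<in> eigsp sc mu a 1 \<and>
                      x0 \<in> eigsp sc mu a 0 \<and> xh \<in> eigsp sc mu a (1/2)) \<and>
     eigsp sc mu a 1 = range (\<lambda>c. sc c a) \<and>
     (\<forall>x\<in>Aplus sc mu a. \<forall>y\<in>Aplus sc mu a. mu x y \<in> Aplus sc mu a) \<and>
     (\<forall>x\<in>Aplus sc mu a. \<forall>y\<in>Aminus sc mu a. mu x y \<in> Aminus sc mu a) \<and>
     (\<forall>x\<in>Aminus sc mu a. \<forall>y\<in>Aminus sc mu a. mu x y \<in> Aplus sc mu a) \<and>
     (\<forall>x\<in>eigsp sc mu a 0. \<forall>y\<in>eigsp sc mu a 0. mu x y \<in> eigsp sc mu a 0)"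

inductive_set alg_gen :: "('k::field \<Rightarrow> 'a::ab_group_add \<Rightarrow> 'a) \<Rightarrow> ('a \<Rightarrow> 'a \<Rightarrow> 'a) \<Rightarrow> 'a set \<Rightarrow> 'a set"
  for sc mu S where
    base: "x \<in> S \<Longrightarrow> x \<in> alg_gen sc mu S"
  | zero: "0 \<in> alg_gen sc mu S"
  | add: "x \<in> alg_gen sc mu S \<Longrightarrow> y \<in> alg_gen sc mu S \<Longrightarrow> x + y \<in> alg_gen sc mu S"
  | smul: "x \<in> alg_gen sc mu S \<Longrightarrow> sc c x \<in> alg_gen sc mu S"
  | mul: "x \<in> alg_gen sc mu S \<Longrightarrow> y \<in> alg_gen sc mu S \<Longrightarrow> mu x y \<in> alg_gen sc mu S"

definition axial_jordan_half :: "('k::field \<Rightarrow> 'a::ab_group_add \<Rightarrow> 'a) \<Rightarrow> ('a \<Rightarrow> 'a \<Rightarrow> 'a) \<Rightarrow> bool" where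
  "axial_jordan_half sc mu \<longleftrightarrow> comm_algebra sc mu \<and>
     (\<exists>Ax. (\<forall>a\<in>Ax. half_axis sc mu a) \<and> alg_gen sc mu Ax = UNIV)"

definition miyamoto :: "('k::field \<Rightarrow> 'a::ab_group_add \<Rightarrow> 'a) \<Rightarrow> ('a \<Rightarrow> 'a \<Rightarrow> 'a) \<Rightarrow> 'a \<Rightarrow> 'a \<Rightarrow> 'a" where
  "miyamoto sc mu a x = (THE y. \<exists>p m. p \<in> Aplus sc mu a \<and> m \<in> Aminus sc mu a \<and>
                                             x = p + m \<and> y = p - m)"

definition closed_axes :: "('k::field \<Rightarrow> 'a::ab_group_add \<Rightarrow> 'a) \<Rightarrow> ('a \<Rightarrow> 'a \<Rightarrow> 'a) \<Rightarrow> 'a set \<Rightarrow> bool" where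
  "closed_axes sc mu Ax \<longleftrightarrow> (\<forall>a\<in>Ax. \<forall>b\<in>Ax. miyamoto sc mu b a \<in> Ax)"

definition Dset :: "('k::field \<Rightarrow> 'a::ab_group_add \<Rightarrow> 'a) \<Rightarrow> ('a \<Rightarrow> 'a \<Rightarrow> 'a) \<Rightarrow> 'a set \<Rightarrow> ('a \<Rightarrow> 'a) set" where
  "Dset sc mu Ax = {miyamoto sc mu a | a. a \<in> Ax \<and> miyamoto sc mu a \<noteq> id}"

definition gen_grp :: "('a \<Rightarrow> 'a) set \<Rightarrow> ('a \<Rightarrow> 'a) monoid" where
  "gen_grp S = (BijGroup (UNIV::'a set))\<lparr>carrier := generate (BijGroup UNIV) S\<rparr>"

definition three_transposition_algebra ::
  "('k::field \<Rightarrow> 'a::ab_group_add \<Rightarrow> 'a) \<Rightarrow> ('a \<Rightarrow> 'a \<Rightarrow> 'a) \<Rightarrow> 'a set \<Rightarrow> bool" where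
  "three_transposition_algebra sc mu Ax \<longleftrightarrow>
     (\<forall>s\<in>Dset sc mu Ax. \<forall>t\<in>Dset sc mu Ax.
        group.ord (gen_grp (Dset sc mu Ax)) (s \<otimes>\<^bsub>gen_grp (Dset sc mu Ax)\<^esub> t) \<in> {1,2,3})"

definition jmult :: "('v \<Rightarrow> 'v \<Rightarrow> 'k::field) \<Rightarrow> ('k \<Rightarrow> 'v::ab_group_add \<Rightarrow> 'v) \<Rightarrow> 'k \<times> 'v \<Rightarrow> 'k \<times> 'v \<Rightarrow> 'k \<times> 'v" where
  "jmult B scv p q = (fst p * fst q + B (snd p) (snd q), scv (fst p) (snd q) + scv (fst q) (snd p))"

definition clifford_iso ::
  "('k::field \<Rightarrow> 'a::ab_group_add \<Rightarrow> 'a) \<Rightarrow> ('a \<Rightarrow> 'a \<Rightarrow> 'a) \<Rightarrow> ('k \<Rightarrow> 'v::ab_group_add \<Rightarrow> 'v) \<Rightarrow> ('v \<Rightarrow> 'v \<Rightarrow> 'k) \<Rightarrow> ('a \<Rightarrow> 'k \<times> 'v) \<Rightarrow> bool" where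
  "clifford_iso sc mu scv B \<phi> \<longleftrightarrow>
     Vector_Spaces.vector_space scv \<and>
     (\<forall>u v w. B (u + v) w = B u w + B v w) \<and>
     (\<forall>c u w. B (scv c u) w = c * B u w) \<and>
     (\<forall>u v. B u v = B v u) \<and>
     bij \<phi> \<and>
     (\<forall>x y. \<phi> (x + y) = (fst (\<phi> x) + fst (\<phi> y), snd (\<phi> x) + snd (\<phi> y))) \<and>
     (\<forall>c x. \<phi> (sc c x) = (c * fst (\<phi> x), scv c (snd (\<phi> x)))) \<and>
     (\<forall>x y. \<phi> (mu x y) = jmult B scv (\<phi> x) (\<phi> y))"

definition conj_class :: "('g, 'b) monoid_scheme \<Rightarrow> 'g \<Rightarrow> 'g set" where
  "conj_class G d = {g \<otimes>\<^bsub>G\<^esub> d \<otimes>\<^bsub>G\<^esub> inv\<^bsub>G\<^esub> g | g. g \<in> carrier G}"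

definition symplectic_type :: "('g, 'b) monoid_scheme \<Rightarrow> 'g set \<Rightarrow> bool" where
  "symplectic_type G D \<longleftrightarrow>
     (\<forall>d\<in>D. \<forall>e\<in>D. \<forall>f\<in>D.
        (G\<lparr>carrier := generate G {e, f}\<rparr> \<cong> sym_group 3) \<longrightarrow>
        d \<otimes>\<^bsub>G\<^esub> e = e \<otimes>\<^bsub>G\<^esub> d \<or> d \<otimes>\<^bsub>G\<^esub> f = f \<otimes>\<^bsub>G\<^esub> d \<or>
        d \<otimes>\<^bsub>G\<^esub> (e \<otimes>\<^bsub>G\<^esub> f \<otimes>\<^bsub>G\<^esub> e) = (e \<otimes>\<^bsub>G\<^esub> f \<otimes>\<^bsub>G\<^esub> e) \<otimes>\<^bsub>G\<^esub> d)"

definition grp_center :: "('g, 'b) monoid_scheme \<Rightarrow> 'g set" where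
  "grp_center G = {z \<in> carrier G. \<forall>g\<in>carrier G. z \<otimes>\<^bsub>G\<^esub> g = g \<otimes>\<^bsub>G\<^esub> z}"

definition D4_roots :: "(real^4) set" where
  "D4_roots = {s *\<^sub>R axis i 1 + t *\<^sub>R axis j 1 | s t i j. i \<noteq> j \<and> s \<in> {1, -1} \<and> t \<in> {1, -1}}"

definition reflection :: "real^4 \<Rightarrow> real^4 \<Rightarrow> real^4" where
  "reflection \<alpha> x = x - (2 * (x \<bullet> \<alpha>) / (\<alpha> \<bullet> \<alpha>)) *\<^sub>R \<alpha>"

definition Weyl_D4 :: "(real^4 \<Rightarrow> real^4) set" where
  "Weyl_D4 = generate (BijGroup UNIV) (reflection ` D4_roots)"

inductive_set D4_lattice :: "(real^4) set" where
    zero: "0 \<in> D4_lattice"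
  | root: "\<alpha> \<in> D4_roots \<Longrightarrow> x \<in> D4_lattice \<Longrightarrow> x + \<alpha> \<in> D4_lattice"
  | neg: "\<alpha> \<in> D4_roots \<Longrightarrow> x \<in> D4_lattice \<Longrightarrow> x - \<alpha> \<in> D4_lattice"

text \<open>Affine Weyl group Weyl(affine D4) = Lambda semidirect Weyl(D4), acting by affine maps.\<close>
definition Weyl_aff_D4 :: "(real^4 \<Rightarrow> real^4) monoid" where
  "Weyl_aff_D4 = (BijGroup UNIV)\<lparr>carrier := {(\<lambda>x. w x + l) | w l. w \<in> Weyl_D4 \<and> l \<in> D4_lattice}\<rparr>"

definition two_Lambda_transl :: "(real^4 \<Rightarrow> real^4) set" where
  "two_Lambda_transl = {(\<lambda>x. x + 2 *\<^sub>R l) | l. l \<in> D4_lattice}"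

definition Weyl2_D4_aff where
  "Weyl2_D4_aff = Weyl_aff_D4 Mod two_Lambda_transl"

definition central_quotient_of :: "('h, 'c) monoid_scheme \<Rightarrow> ('g, 'b) monoid_scheme \<Rightarrow> bool" where
  "central_quotient_of H W \<longleftrightarrow>
     (\<exists>Z. subgroup Z W \<and> Z \<subseteq> grp_center W \<and> H \<cong> W Mod Z)"

definition ADE_type :: "('g, 'b) monoid_scheme \<Rightarrow> 'g set \<Rightarrow> bool" where
  "ADE_type G D \<longleftrightarrow> symplectic_type G D \<and>
     \<not> (\<exists>H. subgroup H G \<and> H = generate G (D \<inter> H) \<and>
            central_quotient_of (G\<lparr>carrier := H\<rparr>) Weyl2_D4_aff)"

end

theory Submission
  imports Defs
begin

text \<open>Under the isomorphism with \<open>J(V,B)\<close> a \<open>1/2\<close>-axis with nontrivial Miyamoto involution is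
  \<open>(e + w)/2\<close> with \<open>B(w,w) = 1\<close>, and its involution acts on \<open>V\<close> as minus the reflection in \<open>w\<close>. The
  3-transposition condition says that two such vectors are equal up to sign or have inner product
  \<open>0\<close> or \<open>\<plusminus>1/2\<close>; in particular inner product \<open>\<plusminus>1\<close> forces equality up to sign. Hence the vectors
  behave like a simply laced root system, which yields symplectic type at once and shows that no
  five distinct commuting elements of \<open>D\<close> share a neighbour in the noncommuting graph.

  On the other hand, let \<open>H\<close> be a central quotient of \<open>Weyl\<^sub>2\<close> of affine \<open>D\<^sub>4\<close>, generated by a normal
  set of 3-transpositions. It maps onto \<open>S\<^sub>3\<close> (the action of \<open>S\<^sub>4\<close> on pairings of the coordinates),
  and the kernel \<open>O\<close> is a 2-group. Some generator \<open>d\<close> acts on the coordinates as a transposition; its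
  conjugates under \<open>O\<close> commute with each other, none of them commutes with a conjugate of \<open>d\<close> lying
  over another transposition of \<open>S\<^sub>3\<close>, and there are at least five of them, obtained by conjugating
  with a sign change, a translation and a double transposition. This holds for every isomorphism
  of \<open>H\<close> with the quotient, so the position of the 3-transpositions inside it is irrelevant.\<close>

section \<open>Bijection groups, central quotients and \<open>S\<^sub>3\<close>\<close>

lemma bij_group_carrier: "carrier (BijGroup UNIV) = {f. bij f}"
  by (auto simp: BijGroup_def Bij_def)

lemma bij_group_mult: "bij f \<Longrightarrow> bij g \<Longrightarrow> f \<otimes>\<^bsub>BijGroup UNIV\<^esub> g = f \<circ> g"
  by (simp add: BijGroup_def Bij_def compose_def restrict_def fun_eq_iff)

lemma bij_group_one: "\<one>\<^bsub>BijGroup UNIV\<^esub> = id"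
  by (simp add: BijGroup_def fun_eq_iff)

lemma bij_group_inv: "bij f \<Longrightarrow> inv\<^bsub>BijGroup UNIV\<^esub> f = Hilbert_Choice.inv f"
  by (simp add: inv_BijGroup Bij_def restrict_def)

text \<open>\<open>q\<close> is the composite of the two projections and the isomorphism. An element
  with trivial image has its \<open>N\<close>-coset in \<open>Z\<close>, hence central in
  \<open>W Mod N\<close>, so it commutes with every \<open>g\<close> up to a factor in
  \<open>N\<close>. This bounds the kernel without first computing a centre.\<close>

lemma central_quotient_hom:
  assumes W: "group W" and N: "N \<lhd> W" and Z: "subgroup Z (W Mod N)"
    and central: "Z \<subseteq> grp_center (W Mod N)" and iso: "K \<cong> (W Mod N) Mod Z" and K: "group K"
  obtains q where "q \<in> hom W K" "q ` carrier W = carrier K" "\<And>x. x \<in> N \<Longrightarrow> q x = \<one>\<^bsub>K\<^esub>"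
    "\<And>x g. x \<in> carrier W \<Longrightarrow> q x = \<one>\<^bsub>K\<^esub> \<Longrightarrow> g \<in> carrier W \<Longrightarrow>
        \<exists>n\<in>N. x \<otimes>\<^bsub>W\<^esub> g = n \<otimes>\<^bsub>W\<^esub> (g \<otimes>\<^bsub>W\<^esub> x)"
proof -
  interpret W: group W by fact
  interpret N: normal N W by fact
  interpret WN: group "W Mod N" by (rule N.factorgroup_is_group)
  have ZN: "Z \<lhd> (W Mod N)"
  proof (rule WN.normalI[OF Z], rule ballI)
    fix x assume x: "x \<in> carrier (W Mod N)"
    have "z \<otimes>\<^bsub>W Mod N\<^esub> x = x \<otimes>\<^bsub>W Mod N\<^esub> z" if "z \<in> Z" for z
      using that x central by (auto simp: grp_center_def)
    then show "Z #>\<^bsub>W Mod N\<^esub> x = x <#\<^bsub>W Mod N\<^esub> Z"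
      unfolding r_coset_def l_coset_def by auto
  qed
  interpret Z: normal Z "W Mod N" by (rule ZN)
  have QG: "group ((W Mod N) Mod Z)" by (rule Z.factorgroup_is_group)
  obtain h where h: "h \<in> iso ((W Mod N) Mod Z) K"
    using group.iso_sym[OF K iso] by (auto simp: is_iso_def)
  define p where "p = (\<lambda>x. N #>\<^bsub>W\<^esub> x)"
  define r where "r = (\<lambda>x. Z #>\<^bsub>W Mod N\<^esub> x)"
  have p: "p \<in> hom W (W Mod N)" unfolding p_def by (rule N.r_coset_hom_Mod)
  have r: "r \<in> hom (W Mod N) ((W Mod N) Mod Z)" unfolding r_def by (rule Z.r_coset_hom_Mod)
  have hh: "h \<in> hom ((W Mod N) Mod Z) K" and hb: "bij_betw h (carrier ((W Mod N) Mod Z)) (carrier K)"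
    using h by (auto simp: iso_def)
  have ps: "p ` carrier W = carrier (W Mod N)"
    by (auto simp: p_def FactGroup_def RCOSETS_def)
  have rs: "r ` carrier (W Mod N) = carrier ((W Mod N) Mod Z)"
    unfolding r_def by (subst (2) FactGroup_def) (auto simp: RCOSETS_def)
  have hs: "h ` carrier ((W Mod N) Mod Z) = carrier K"
    using hb by (simp add: bij_betw_def)
  have h1: "h \<one>\<^bsub>(W Mod N) Mod Z\<^esub> = \<one>\<^bsub>K\<^esub>" by (rule hom_one[OF hh QG K])
  show thesis
  proof
    show "h \<circ> (r \<circ> p) \<in> hom W K"
      by (intro hom_compose[OF hom_compose[OF p r] hh])
    show "(h \<circ> (r \<circ> p)) ` carrier W = carrier K"
      by (simp only: image_comp[symmetric] ps rs hs)
    show "(h \<circ> (r \<circ> p)) x = \<one>\<^bsub>K\<^esub>" if "x \<in> N" for x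
    proof -
      have "p x = \<one>\<^bsub>W Mod N\<^esub>"
        using that N.subset W.coset_join2[of x N] N.is_subgroup by (auto simp: p_def FactGroup_def)
      moreover have "r \<one>\<^bsub>W Mod N\<^esub> = \<one>\<^bsub>(W Mod N) Mod Z\<^esub>" by (rule hom_one[OF r WN.is_group QG])
      ultimately show ?thesis using h1 by simp
    qed
    fix x g assume x: "x \<in> carrier W" and q1: "(h \<circ> (r \<circ> p)) x = \<one>\<^bsub>K\<^esub>" and g: "g \<in> carrier W"
    have px: "p x \<in> carrier (W Mod N)" and pg: "p g \<in> carrier (W Mod N)" using x g ps by auto
    have "r (p x) = \<one>\<^bsub>(W Mod N) Mod Z\<^esub>"
    proof (rule inj_onD[OF bij_betw_imp_inj_on[OF hb]])
      show "h (r (p x)) = h \<one>\<^bsub>(W Mod N) Mod Z\<^esub>" unfolding h1 using q1 by simp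
      show "r (p x) \<in> carrier ((W Mod N) Mod Z)" using px rs by blast
      show "\<one>\<^bsub>(W Mod N) Mod Z\<^esub> \<in> carrier ((W Mod N) Mod Z)"
        using QG by (rule monoid.one_closed[OF group.is_monoid])
    qed
    then have "Z #>\<^bsub>W Mod N\<^esub> p x = Z" by (simp add: r_def FactGroup_def[of "W Mod N"])
    then have "p x \<in> Z" using WN.rcos_self[OF px Z] by simp
    then have "p x \<otimes>\<^bsub>W Mod N\<^esub> p g = p g \<otimes>\<^bsub>W Mod N\<^esub> p x"
      using central pg by (auto simp: grp_center_def)
    then have "p (x \<otimes>\<^bsub>W\<^esub> g) = p (g \<otimes>\<^bsub>W\<^esub> x)"
      using p x g by (simp add: hom_mult)
    then have "x \<otimes>\<^bsub>W\<^esub> g \<in> N #>\<^bsub>W\<^esub> (g \<otimes>\<^bsub>W\<^esub> x)"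
      using W.rcos_self[OF W.m_closed[OF x g] N.is_subgroup] by (simp add: p_def)
    then show "\<exists>n\<in>N. x \<otimes>\<^bsub>W\<^esub> g = n \<otimes>\<^bsub>W\<^esub> (g \<otimes>\<^bsub>W\<^esub> x)"
      by (auto simp: r_coset_def)
  qed
qed

text \<open>Centralisers are closed under products and inverses (\<open>gen\<close>). This gives
  first that \<open>e\<close> and \<open>f\<close> commute with \<open>y\<close>, and then, with
  \<open>y\<close> in the place of \<open>z\<close>, that \<open>y\<close> commutes with
  \<open>x\<close>.\<close>

lemma generate_pair_commute:
  fixes G (structure)
  assumes G: "group G" and e: "e \<in> carrier G" and f: "f \<in> carrier G"
    and ef: "e \<otimes>\<^bsub>G\<^esub> f = f \<otimes>\<^bsub>G\<^esub> e"
    and x: "x \<in> generate G {e, f}" and y: "y \<in> generate G {e, f}"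
  shows "x \<otimes>\<^bsub>G\<^esub> y = y \<otimes>\<^bsub>G\<^esub> x"
proof -
  interpret group G by fact
  have inv_comm: "z \<otimes> inv a = inv a \<otimes> z"
    if "z \<in> carrier G" "a \<in> carrier G" "z \<otimes> a = a \<otimes> z" for z a
    using that by (metis inv_closed inv_solve_right m_assoc m_closed r_inv r_one inv_solve_left)
  have gen: "z \<otimes> y = y \<otimes> z"
    if z: "z \<in> carrier G" "z \<otimes> e = e \<otimes> z" "z \<otimes> f = f \<otimes> z" and "y \<in> generate G {e, f}" for z y
    using that(4)
  proof induction
    case one then show ?case using z by simp
  next
    case (incl h) then show ?case using z by auto
  next
    case (inv h) then show ?case using z e f inv_comm by auto
  next
    case (eng h1 h2)
    then have "h1 \<in> carrier G" "h2 \<in> carrier G"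
      using e f generate_in_carrier[of "{e,f}"] by auto
    then show ?case using eng.IH z by (metis m_assoc)
  qed
  have "e \<otimes> y = y \<otimes> e" "f \<otimes> y = y \<otimes> f" using gen[OF _ _ _ y] e f ef by auto
  moreover have "y \<in> carrier G" using y e f generate_in_carrier[of "{e,f}"] by auto
  ultimately show ?thesis using gen[OF _ _ _ x, of y] by auto
qed

lemma sym_group_3_not_commutative:
  "\<exists>x\<in>carrier (sym_group 3). \<exists>y\<in>carrier (sym_group 3).
     x \<otimes>\<^bsub>sym_group 3\<^esub> y \<noteq> y \<otimes>\<^bsub>sym_group 3\<^esub> x"
proof -
  let ?x = "Transposition.transpose 1 (2::nat)" and ?y = "Transposition.transpose 2 (3::nat)"
  have "?x \<in> carrier (sym_group 3)" "?y \<in> carrier (sym_group 3)"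
    by (auto simp: sym_group_def intro!: permutes_swap_id)
  moreover have "(?x \<circ> ?y) 1 \<noteq> (?y \<circ> ?x) 1"
    by (simp add: Transposition.transpose_def)
  then have "?x \<otimes>\<^bsub>sym_group 3\<^esub> ?y \<noteq> ?y \<otimes>\<^bsub>sym_group 3\<^esub> ?x"
    by (metis monoid.select_convs(1) sym_group_def)
  ultimately show ?thesis by blast
qed

text \<open>Commuting \<open>e\<close> and \<open>f\<close> would generate an abelian group, and the
  isomorphism would make the symmetric group abelian.\<close>

lemma generate_pair_iso_sym_group_3:
  assumes G: "group G" and e: "e \<in> carrier G" and f: "f \<in> carrier G"
    and iso: "G\<lparr>carrier := generate G {e, f}\<rparr> \<cong> sym_group 3"
  shows "e \<otimes>\<^bsub>G\<^esub> f \<noteq> f \<otimes>\<^bsub>G\<^esub> e"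
proof
  assume ef: "e \<otimes>\<^bsub>G\<^esub> f = f \<otimes>\<^bsub>G\<^esub> e"
  obtain h where hom: "h \<in> hom (G\<lparr>carrier := generate G {e, f}\<rparr>) (sym_group 3)"
    and onto: "h ` generate G {e, f} = carrier (sym_group 3)"
    using iso by (auto simp: is_iso_def iso_def bij_betw_def)
  have "x \<otimes>\<^bsub>sym_group 3\<^esub> y = y \<otimes>\<^bsub>sym_group 3\<^esub> x"
    if xy: "x \<in> carrier (sym_group 3)" "y \<in> carrier (sym_group 3)" for x y
  proof -
    obtain a b where "a \<in> generate G {e, f}" "b \<in> generate G {e, f}" "x = h a" "y = h b"
      using xy onto by blast
    then show ?thesis
      using hom_mult[OF hom, of a b] hom_mult[OF hom, of b a] generate_pair_commute[OF G e f ef, of a b]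
      by simp
  qed
  then show False using sym_group_3_not_commutative by blast
qed

section \<open>Reflections of unit vectors\<close>

locale sym_bilinear = vector_space scv
  for scv :: "'k::field \<Rightarrow> 'v::ab_group_add \<Rightarrow> 'v" +
  fixes B :: "'v \<Rightarrow> 'v \<Rightarrow> 'k"
  assumes B_add_left: "B (u + v) w = B u w + B v w"
    and B_scale_left: "B (scv c u) w = c * B u w"
    and B_sym: "B u v = B v u"
begin

text \<open>For \<open>B w w = 1\<close> this fixes \<open>w\<close> and negates its orthogonal
  complement, so it is the negative of the usual reflection. The sign matches a Miyamoto involution,
  whose \<open>-1\<close> part is that complement.\<close>

definition neg_refl :: "'v \<Rightarrow> 'v \<Rightarrow> 'v" where
  "neg_refl w x = scv (2 * B x w) w - x"

lemma B_add_right: "B w (u + v) = B w u + B w v"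
  by (metis B_add_left B_sym)

lemma B_scale_right: "B w (scv c u) = c * B w u"
  by (metis B_scale_left B_sym)

lemma B_minus_left: "B (- u) w = - B u w"
  using B_scale_left[of "-1" u w] by simp

lemma B_minus_right: "B w (- u) = - B w u"
  by (metis B_minus_left B_sym)

lemma B_diff_left: "B (u - v) w = B u w - B v w"
  using B_add_left[of u "- v" w] by (simp add: B_minus_left)

lemma B_diff_right: "B w (u - v) = B w u - B w v"
  by (metis B_diff_left B_sym)

lemmas B_simps = B_add_left B_add_right B_scale_left B_scale_right B_minus_left B_minus_right
  B_diff_left B_diff_right

lemma neg_refl_minus: "neg_refl (- w) = neg_refl w"
  by (simp add: neg_refl_def fun_eq_iff B_simps)

lemma scale_two: "scv 2 x = x + x"
  using scale_left_distrib[of 1 1 x] by simp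

lemma neg_refl_self: "B w w = 1 \<Longrightarrow> neg_refl w w = w"
  by (simp add: neg_refl_def scale_two)

lemma B_neg_refl: "B w w = 1 \<Longrightarrow> B (neg_refl w x) (neg_refl w y) = B x y"
  by (simp add: neg_refl_def B_simps B_sym[of w x] B_sym[of w y] algebra_simps)

lemma neg_refl_involution: "B w w = 1 \<Longrightarrow> neg_refl w (neg_refl w x) = x"
  by (simp add: neg_refl_def B_simps scale_left_diff_distrib algebra_simps)

text \<open>An isometry conjugates the involution of \<open>v\<close> into the involution of the
  image of \<open>v\<close>. The first fact is self-adjointness of \<open>neg_refl w\<close>, which
  follows because it is an isometric involution.\<close>

lemma neg_refl_conj:
  assumes "B w w = 1"
  shows "neg_refl w \<circ> neg_refl v \<circ> neg_refl w = neg_refl (neg_refl w v)"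
proof
  fix x
  have "B (neg_refl w x) v = B x (neg_refl w v)"
    using B_neg_refl[OF assms, of "neg_refl w x" v] by (simp add: neg_refl_involution[OF assms])
  moreover have "neg_refl w (scv c v - y) = scv c (neg_refl w v) - neg_refl w y" for c y
    by (simp add: neg_refl_def B_simps algebra_simps scale_left_diff_distrib scale_right_diff_distrib)
  ultimately show "(neg_refl w \<circ> neg_refl v \<circ> neg_refl w) x = neg_refl (neg_refl w v) x"
    by (simp add: neg_refl_def[of v] neg_refl_involution[OF assms])
       (simp add: neg_refl_def)
qed

lemma neg_refl_orthogonal_commute:
  assumes "B w v = 0"
  shows "neg_refl w \<circ> neg_refl v = neg_refl v \<circ> neg_refl w"
  using assms B_sym[of v w] by (simp add: neg_refl_def fun_eq_iff B_simps)

lemma unit_parallel: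
  assumes v: "B v v = 1" and w: "B w w = 1" and eq: "w = scv c v"
  shows "v = w \<or> v = - w"
proof -
  have "c * c = 1"
    using w by (simp add: eq B_simps v)
  then have "c = 1 \<or> c = - 1" by (simp add: square_eq_1_iff)
  then show ?thesis using eq by auto
qed

context
  assumes two: "(2::'k) \<noteq> 0"
begin

text \<open>Cancelling 2 shows that fixed vectors lie on the line of \<open>v\<close>; this is how
  an involution determines its vector up to sign.\<close>

lemma neg_refl_fixed:
  assumes "neg_refl v x = x"
  shows "x = scv (B x v) v"
proof -
  have "scv 2 x = scv 2 (scv (B x v) v)"
    using assms by (simp add: neg_refl_def scale_two algebra_simps)
  then show ?thesis using two by (metis scale_cancel_left)
qed

lemma neg_refl_eq_iff:
  assumes v: "B v v = 1" and w: "B w w = 1"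
  shows "neg_refl v = neg_refl w \<longleftrightarrow> v = w \<or> v = - w"
proof
  assume eq: "neg_refl v = neg_refl w"
  have *: "w = scv (B w v) v"
    by (rule neg_refl_fixed) (simp add: eq neg_refl_self w)
  show "v = w \<or> v = - w" by (rule unit_parallel[OF v w *])
qed (auto simp: neg_refl_minus)

text \<open>Conjugation by \<open>neg_refl w\<close> preserves \<open>neg_refl v\<close>, so
  \<open>neg_refl w\<close> sends \<open>v\<close> to \<open>v\<close> or \<open>- v\<close>. A
  fixed \<open>v\<close> is parallel to \<open>w\<close>, a negated one is orthogonal to it.\<close>

lemma neg_refl_order_two:
  assumes v: "B v v = 1" and w: "B w w = 1"
    and comm: "neg_refl w \<circ> neg_refl v = neg_refl v \<circ> neg_refl w"
  shows "v = w \<or> v = - w \<or> B w v = 0"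
proof -
  have "neg_refl (neg_refl w v) = neg_refl v"
    unfolding neg_refl_conj[OF w, symmetric] comm
    by (simp add: fun_eq_iff neg_refl_involution[OF w])
  then consider "neg_refl w v = v" | "neg_refl w v = - v"
    using neg_refl_eq_iff[of "neg_refl w v" v] v B_neg_refl[OF w] by auto
  then show ?thesis
  proof cases
    case 1
    then show ?thesis
      using unit_parallel[OF w v neg_refl_fixed[OF 1]] by auto
  next
    case 2
    then have "scv (2 * B v w) w = 0" by (simp add: neg_refl_def)
    moreover have "w \<noteq> 0" using w B_scale_left[of 0 w w] by auto
    ultimately show ?thesis using two B_sym[of v w] by simp
  qed
qed

text \<open>By the braid relation each involution conjugates the other to the same element, so
  \<open>neg_refl w v\<close> and \<open>neg_refl v w\<close> agree up to sign. With
  \<open>c = 2 * B w v\<close> this says that \<open>c + 1\<close> annihilates \<open>w - v\<close>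
  or \<open>c - 1\<close> annihilates \<open>w + v\<close>.\<close>

lemma neg_refl_order_three:
  assumes v: "B v v = 1" and w: "B w w = 1"
    and braid: "neg_refl w \<circ> neg_refl v \<circ> neg_refl w = neg_refl v \<circ> neg_refl w \<circ> neg_refl v"
  shows "v = w \<or> v = - w \<or> 2 * B w v = 1 \<or> 2 * B w v = - 1"
proof -
  define c where "c = 2 * B w v"
  have "neg_refl w v = neg_refl v w \<or> neg_refl w v = - neg_refl v w"
    using braid by (simp add: neg_refl_conj v w neg_refl_eq_iff B_neg_refl)
  then consider "scv c w - v = scv c v - w" | "scv c w - v = - (scv c v - w)"
    by (auto simp: neg_refl_def c_def B_sym[of v w])
  then show ?thesis
  proof cases
    case 1
    then have "scv (c + 1) w = scv (c + 1) v"
      by (simp add: scale_left_distrib algebra_simps)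
    then have "c + 1 = 0 \<or> w = v" by (metis scale_cancel_left)
    then show ?thesis by (auto simp: c_def eq_neg_iff_add_eq_0)
  next
    case 2
    then have "scv (c - 1) w = scv (c - 1) (- v)"
      by (simp add: scale_left_diff_distrib algebra_simps)
    then have "c - 1 = 0 \<or> w = - v" by (metis scale_cancel_left)
    then show ?thesis by (auto simp: c_def)
  qed
qed

end

end

text \<open>\<open>Phi\<close> plays the role of a simply laced root system scaled to norm 1. Over a
  general field no positivity is available to bound inner products; the commutation and braid
  relations in \<open>order\<close> do this instead.\<close>

locale three_transposition_vectors = sym_bilinear scv B
  for scv :: "'k::field \<Rightarrow> 'v::ab_group_add \<Rightarrow> 'v" and B +
  fixes Phi :: "'v set"
  assumes two: "(2::'k) \<noteq> 0" and three: "(3::'k) \<noteq> 0"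
    and unit: "w \<in> Phi \<Longrightarrow> B w w = 1"
    and minus_closed: "w \<in> Phi \<Longrightarrow> - w \<in> Phi"
    and refl_closed: "w \<in> Phi \<Longrightarrow> v \<in> Phi \<Longrightarrow> neg_refl w v \<in> Phi"
    and order: "w \<in> Phi \<Longrightarrow> v \<in> Phi \<Longrightarrow>
      neg_refl w \<circ> neg_refl v = neg_refl v \<circ> neg_refl w \<or>
      neg_refl w \<circ> neg_refl v \<circ> neg_refl w = neg_refl v \<circ> neg_refl w \<circ> neg_refl v"
begin

lemma two_neq_one: "(2::'k) \<noteq> 1"
  by (metis one_add_one add_cancel_right_right zero_neq_one)

lemma Phi_cases:
  assumes "w \<in> Phi" "v \<in> Phi"
  shows "v = w \<or> v = - w \<or> B w v = 0 \<or> 2 * B w v = 1 \<or> 2 * B w v = - 1"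
  using order[OF assms] neg_refl_order_two[OF two] neg_refl_order_three[OF two] unit assms by blast

lemma two_B_if_not_commute:
  assumes "w \<in> Phi" "v \<in> Phi" "neg_refl w \<circ> neg_refl v \<noteq> neg_refl v \<circ> neg_refl w"
  shows "2 * B w v = 1 \<or> 2 * B w v = - 1"
  using Phi_cases[OF assms(1,2)] assms(3) neg_refl_orthogonal_commute neg_refl_minus by metis

text \<open>If \<open>d\<close> commuted with none of the three, then \<open>c\<close>,
  \<open>x\<close>, \<open>y\<close> and \<open>z = c * x - y\<close> would all be 1 or -1. But such
  a \<open>z\<close> is 0, 2 or -2, and 2 differs from both 1 and -1 outside characteristic
  3.\<close>

lemma commute_with_S3:
  assumes d: "d \<in> Phi" and e: "e \<in> Phi" and f: "f \<in> Phi"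
    and ef: "neg_refl e \<circ> neg_refl f \<noteq> neg_refl f \<circ> neg_refl e"
  shows "neg_refl d \<circ> neg_refl e = neg_refl e \<circ> neg_refl d \<or>
    neg_refl d \<circ> neg_refl f = neg_refl f \<circ> neg_refl d \<or>
    neg_refl d \<circ> neg_refl (neg_refl e f) = neg_refl (neg_refl e f) \<circ> neg_refl d"
proof (rule ccontr)
  assume "\<not> ?thesis"
  then have x: "2 * B d e = 1 \<or> 2 * B d e = - 1" and y: "2 * B d f = 1 \<or> 2 * B d f = - 1"
    and z: "2 * B d (neg_refl e f) = 1 \<or> 2 * B d (neg_refl e f) = - 1"
    using two_B_if_not_commute d e f refl_closed by blast+
  have c: "2 * B e f = 1 \<or> 2 * B e f = - 1" using two_B_if_not_commute[OF e f ef] .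
  have zz: "2 * B d (neg_refl e f) = (2 * B e f) * (2 * B d e) - 2 * B d f"
    by (simp add: neg_refl_def B_simps B_sym[of f e] algebra_simps)
  have pm1: False if "c = 1 \<or> c = - 1" "x = 1 \<or> x = - 1" "y = 1 \<or> y = - 1" "z = 1 \<or> z = - 1"
    "z = c * x - y" for c x y z :: 'k
  proof -
    have "(2::'k) \<noteq> - 1" "(1::'k) \<noteq> - 2"
      using three by (auto simp: eq_neg_iff_add_eq_0)
    then show False
      using that(5) two_neq_one two_neq_one[symmetric]
      by - (rule disjE[OF that(1)]; rule disjE[OF that(2)]; rule disjE[OF that(3)];
            rule disjE[OF that(4)]; simp)
  qed
  show False by (rule pm1[OF c x y z zz])
qed

text \<open>After fixing signs, \<open>b\<close> and any four of the \<open>w i\<close> form an affine \<open>D\<^sub>4\<close> diagram. The highest root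
  \<open>2b - w 1 - w 2 - w 3\<close> of the \<open>D\<^sub>4\<close> on \<open>b, w 1, w 2, w 3\<close> has inner product 1 with both \<open>w 4\<close> and
  \<open>w 5\<close>, which forces it to equal both of them.\<close>

lemma no_five_commuting:
  assumes b: "b \<in> Phi" and W: "\<And>i. i \<in> {1..5::nat} \<Longrightarrow> w i \<in> Phi"
    and comm: "\<And>i j. i \<in> {1..5} \<Longrightarrow> j \<in> {1..5} \<Longrightarrow>
        neg_refl (w i) \<circ> neg_refl (w j) = neg_refl (w j) \<circ> neg_refl (w i)"
    and ncomm: "\<And>i. i \<in> {1..5} \<Longrightarrow> neg_refl (w i) \<circ> neg_refl b \<noteq> neg_refl b \<circ> neg_refl (w i)"
    and dist: "\<And>i j. i \<in> {1..5} \<Longrightarrow> j \<in> {1..5} \<Longrightarrow> i \<noteq> j \<Longrightarrow> neg_refl (w i) \<noteq> neg_refl (w j)"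
  shows False
proof -
  \<comment> \<open>A change of sign leaves the involution alone; this choice makes every
    \<open>2 * B (v i) b\<close> equal to 1, a star centred at \<open>b\<close>.\<close>
  define v where "v i = (if 2 * B (w i) b = 1 then w i else - w i)" for i
  have nr: "neg_refl (v i) = neg_refl (w i)" for i by (simp add: v_def neg_refl_minus)
  have V: "v i \<in> Phi" if "i \<in> {1..5}" for i using W[OF that] minus_closed by (simp add: v_def)
  have vb: "2 * B (v i) b = 1" if "i \<in> {1..5}" for i
    using two_B_if_not_commute[OF W[OF that] b ncomm[OF that]] by (auto simp: v_def B_simps)
  have vv: "B (v i) (v j) = 0" if "i \<in> {1..5}" "j \<in> {1..5}" "i \<noteq> j" for i j
    using neg_refl_order_two[OF two unit[OF V[OF that(2)]] unit[OF V[OF that(1)]]]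
      comm[OF that(1,2)] dist[OF that] nr neg_refl_minus by metis
  \<comment> \<open>The usual reflection in \<open>v i\<close> is \<open>- neg_refl (v i)\<close>;
    on such an \<open>x\<close> it subtracts exactly \<open>v i\<close>.\<close>
  have step: "x - v i \<in> Phi" if "x \<in> Phi" "i \<in> {1..5}" "2 * B x (v i) = 1" for x i
    using minus_closed[OF refl_closed[OF V[OF that(2)] that(1)]] that(3)
    by (simp add: neg_refl_def)
  have b1: "b - v 1 \<in> Phi" using step[OF b, of 1] vb[of 1] by (simp add: B_sym)
  have b2: "b - v 1 - v 2 \<in> Phi"
    using step[OF b1, of 2] vb[of 2] vv[of 1 2] by (simp add: B_simps B_sym)
  have b3: "b - v 1 - v 2 - v 3 \<in> Phi"
    using step[OF b2, of 3] vb[of 3] vv[of 1 3] vv[of 2 3] by (simp add: B_simps B_sym)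
  define t where "t = b - v 1 - v 2 - v 3 + b"
  \<comment> \<open>The value is 2 - 1 - 1 - 1, so the usual reflection in \<open>b\<close> adds
    \<open>b\<close> and produces \<open>t\<close>.\<close>
  have "2 * B (b - v 1 - v 2 - v 3) b = - 1"
    using unit[OF b] vb[of 1] vb[of 2] vb[of 3] by (simp add: B_simps algebra_simps)
  then have "- neg_refl b (b - v 1 - v 2 - v 3) = t"
    by (simp add: neg_refl_def t_def)
  then have t: "t \<in> Phi" using minus_closed[OF refl_closed[OF b b3]] by simp
  have tv: "t = v i" if i: "i \<in> {4,5}" for i
  proof -
    have Bt: "B t (v i) = 1"
      using vb[of i] vv[of 1 i] vv[of 2 i] vv[of 3 i] i
      by (auto simp: t_def B_simps B_sym[of b "v i"])
    have "v i \<in> Phi" using V i by auto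
    \<comment> \<open>With inner product 1 the other cases would read 1 = 0, 2 = 1 or 2 = -1, the
      last being excluded by the characteristic.\<close>
    from Phi_cases[OF t this] Bt have "v i = t \<or> v i = - t"
      using two three two_neq_one by (simp add: eq_neg_iff_add_eq_0)
    moreover have "v i \<noteq> - t"
      using Bt unit[OF t] two by (auto simp: B_simps)
    ultimately show ?thesis by auto
  qed
  have "v 4 = v 5" using tv[of 4] tv[of 5] by simp
  then show False using nr[of 4] nr[of 5] dist[of 4 5] by simp
qed

end

section \<open>Miyamoto involutions of Clifford type algebras\<close>

text \<open>The first component is the coordinate along the unit, which a Miyamoto involution fixes;
  only a map on the \<open>V\<close> component has to be carried back along
  \<open>\<phi>\<close>.\<close>

definition lift_id_prod :: "('a \<Rightarrow> 'k \<times> 'v) \<Rightarrow> ('v \<Rightarrow> 'v) \<Rightarrow> 'a \<Rightarrow> 'a" where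
  "lift_id_prod \<phi> f = Hilbert_Choice.inv \<phi> \<circ> map_prod id f \<circ> \<phi>"

lemma lift_id_prod_apply: "bij \<phi> \<Longrightarrow> \<phi> (lift_id_prod \<phi> f x) = (fst (\<phi> x), f (snd (\<phi> x)))"
  by (simp add: lift_id_prod_def bij_is_surj surj_f_inv_f map_prod_def split_beta)

lemma eq_lift_id_prod_iff:
  "bij \<phi> \<Longrightarrow> y = lift_id_prod \<phi> f x \<longleftrightarrow> \<phi> y = (fst (\<phi> x), f (snd (\<phi> x)))"
  by (metis bij_is_inj injD lift_id_prod_apply)

lemma lift_id_prod_comp:
  "bij \<phi> \<Longrightarrow> lift_id_prod \<phi> f \<circ> lift_id_prod \<phi> g = lift_id_prod \<phi> (f \<circ> g)"
  by (simp add: fun_eq_iff eq_lift_id_prod_iff lift_id_prod_apply)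

lemma lift_id_prod_eq_iff:
  assumes "bij \<phi>"
  shows "lift_id_prod \<phi> f = lift_id_prod \<phi> g \<longleftrightarrow> f = g"
proof
  assume eq: "lift_id_prod \<phi> f = lift_id_prod \<phi> g"
  show "f = g"
  proof
    fix v
    \<comment> \<open>The first component passes through unchanged, so any value can stand
      there.\<close>
    obtain x where "\<phi> x = (undefined, v)" using assms by (metis bij_pointE)
    then show "f v = g v"
      using lift_id_prod_apply[OF assms, of f x] lift_id_prod_apply[OF assms, of g x] eq by simp
  qed
qed simp

lemma lift_id_prod_id: "bij \<phi> \<Longrightarrow> lift_id_prod \<phi> id = id"
  using eq_lift_id_prod_iff[of \<phi> _ id] by (simp add: fun_eq_iff) (metis prod.collapse)

lemma sym_bilinear_clifford: "clifford_iso sc mu scv B \<phi> \<Longrightarrow> sym_bilinear scv B"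
  by (auto simp: clifford_iso_def sym_bilinear_def sym_bilinear_axioms_def)

text \<open>For the image \<open>(\<alpha>, u)\<close> of \<open>a\<close>, idempotency gives
  \<open>2 \<alpha> u = u\<close>. If \<open>u = 0\<close>, then \<open>\<alpha>\<close> is 0 or 1,
  the eigenspace of 1/2 vanishes and the involution is trivial. Otherwise
  \<open>\<alpha> = 1/2\<close> and \<open>4 * B u u = 1\<close>, so \<open>w = 2 u\<close> has norm
  1.\<close>

lemma miyamoto_clifford:
  fixes scv :: "'k::field \<Rightarrow> 'v::ab_group_add \<Rightarrow> 'v" and sc :: "'k \<Rightarrow> 'a::ab_group_add \<Rightarrow> 'a"
  assumes two: "(2::'k) \<noteq> 0" and cl: "clifford_iso sc mu scv B \<phi>"
    and ax: "half_axis sc mu a" and nid: "miyamoto sc mu a \<noteq> id"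
  obtains w where "B w w = 1" "miyamoto sc mu a = lift_id_prod \<phi> (sym_bilinear.neg_refl scv B w)"
proof -
  interpret sym_bilinear scv B by (rule sym_bilinear_clifford[OF cl])
  have bij: "bij \<phi>" and add: "\<And>x y. \<phi> (x + y) = (fst (\<phi> x) + fst (\<phi> y), snd (\<phi> x) + snd (\<phi> y))"
    and scale: "\<And>c x. \<phi> (sc c x) = (c * fst (\<phi> x), scv c (snd (\<phi> x)))"
    and mul: "\<And>x y. \<phi> (mu x y) = jmult B scv (\<phi> x) (\<phi> y)"
    using cl by (auto simp: clifford_iso_def)
  have inj: "\<phi> x = \<phi> y \<longleftrightarrow> x = y" for x y using bij by (simp add: bij_is_inj inj_eq)
  have diff: "\<phi> (x - y) = (fst (\<phi> x) - fst (\<phi> y), snd (\<phi> x) - snd (\<phi> y))" for x y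
    using add[of "x - y" y] by (simp add: prod_eq_iff)
  have zero: "\<phi> 0 = (0, 0)" using diff[of 0 0] by simp
  define \<alpha> u where "\<alpha> = fst (\<phi> a)" and "u = snd (\<phi> a)"
  have idem: "\<alpha> * \<alpha> + B u u = \<alpha>" "scv \<alpha> u + scv \<alpha> u = u"
    using mul[of a a] ax
    unfolding half_axis_def jmult_def \<alpha>_def u_def by (metis fst_conv, metis snd_conv)
  have eig: "x \<in> eigsp sc mu a l \<longleftrightarrow>
      fst (\<phi> x) * \<alpha> + B (snd (\<phi> x)) u = l * fst (\<phi> x) \<and>
      scv (fst (\<phi> x)) u + scv \<alpha> (snd (\<phi> x)) = scv l (snd (\<phi> x))" for x l
    unfolding eigsp_def using inj[of "mu x a" "sc l x"]
    by (simp add: mul scale jmult_def \<alpha>_def u_def prod_eq_iff)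
  have decomp: "\<exists>p m. p \<in> Aplus sc mu a \<and> m \<in> Aminus sc mu a \<and> x = p + m" for x
  proof -
    obtain x1 x0 xh where "x = x1 + x0 + xh" "x1 \<in> eigsp sc mu a 1" "x0 \<in> eigsp sc mu a 0"
      "xh \<in> eigsp sc mu a (1/2)"
      using ax unfolding half_axis_def by metis
    then show ?thesis unfolding Aplus_def Aminus_def by blast
  qed
  \<comment> \<open>A map taking \<open>p + m\<close> to \<open>p - m\<close> for all such
    \<open>p\<close> and \<open>m\<close> settles both existence and uniqueness in the definite
    description.\<close>
  have miyI: "miyamoto sc mu a = F"
    if F: "\<And>p m. p \<in> Aplus sc mu a \<Longrightarrow> m \<in> Aminus sc mu a \<Longrightarrow> p - m = F (p + m)" for F
  proof
    fix x
    show "miyamoto sc mu a x = F x"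
      unfolding miyamoto_def
    proof (rule the_equality)
      show "\<exists>p m. p \<in> Aplus sc mu a \<and> m \<in> Aminus sc mu a \<and> x = p + m \<and> F x = p - m"
        using decomp[of x] F by metis
    qed (use F in auto)
  qed
  have half: "(1/2::'k) \<noteq> 1" "(1/2::'k) \<noteq> 0"
    using two by (auto simp: field_simps) (metis one_add_one add_cancel_right_right zero_neq_one)
  have u0: "u \<noteq> 0"
  proof
    assume u: "u = 0"
    have "B u u = 0" using B_scale_left[of 0 u u] by (simp add: u)
    then have "\<alpha> * (\<alpha> - 1) = 0" using idem(1) by (simp add: algebra_simps)
    then have a: "\<alpha> = 0 \<or> \<alpha> = 1" by auto
    have "m = 0" if "m \<in> Aminus sc mu a" for m
    proof -
      have "B (snd (\<phi> m)) u = 0" using B_scale_right[of _ 0 u] by (simp add: u)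
      then have "fst (\<phi> m) * \<alpha> = 1/2 * fst (\<phi> m)" "scv \<alpha> (snd (\<phi> m)) = scv (1/2) (snd (\<phi> m))"
        using that unfolding Aminus_def eig by (simp_all add: u)
      then have "(\<alpha> - 1/2) * fst (\<phi> m) = 0" "scv (\<alpha> - 1/2) (snd (\<phi> m)) = 0"
        by (simp_all add: algebra_simps)
      moreover have "\<alpha> - 1/2 \<noteq> 0" using a half by auto
      ultimately have "\<phi> m = (0, 0)" by (simp add: prod_eq_iff)
      then show "m = 0" using inj[of m 0] by (simp add: zero)
    qed
    then have "miyamoto sc mu a = id" by (intro miyI) fastforce
    then show False using nid by simp
  qed
  have "scv (2 * \<alpha> - 1) u = 0" using idem(2) by (simp add: scale_left_diff_distrib scale_two flip: scale_scale)
  then have "2 * \<alpha> - 1 = 0" using u0 by (metis scale_eq_0_iff)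
  then have a2: "2 * \<alpha> = 1" by simp
  then have al: "\<alpha> = 1/2" using two by (simp add: field_simps)
  have Bu': "B u u = \<alpha> - \<alpha> * \<alpha>" using idem(1) by (simp add: algebra_simps)
  have "4 * B u u = 2 * (2 * \<alpha>) - (2 * \<alpha>) * (2 * \<alpha>)" unfolding Bu' by (simp add: algebra_simps)
  then have Bu: "4 * B u u = 1" unfolding a2 by simp
  define w where "w = scv 2 u"
  have w1: "B w w = 1" using Bu by (simp add: w_def B_simps)
  have "miyamoto sc mu a = lift_id_prod \<phi> (neg_refl w)"
  proof (rule miyI)
    fix p m assume p: "p \<in> Aplus sc mu a" and m: "m \<in> Aminus sc mu a"
    obtain x y where p_eq: "p = x + y" and x: "x \<in> eigsp sc mu a 1" and y: "y \<in> eigsp sc mu a 0"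
      using p by (auto simp: Aplus_def)
    have dbl: "scv (1/2) v + scv (1/2) v = v" for v
      using two by (simp flip: scale_left_distrib)
    \<comment> \<open>Solving the eigenvector equations gives \<open>(c, c w)\<close> for eigenvalue
      1 and \<open>(c, - c w)\<close> for eigenvalue 0, so the \<open>V\<close> component of
      \<open>p\<close> lies on the line of \<open>w\<close>.\<close>
    have hx: "scv (fst (\<phi> x)) u + scv (1/2) (snd (\<phi> x)) = snd (\<phi> x)" using x by (simp add: eig al)
    have hy: "scv (fst (\<phi> y)) u + scv (1/2) (snd (\<phi> y)) = 0" using y by (simp add: eig al)
    have hx': "scv (fst (\<phi> x)) u = scv (1/2) (snd (\<phi> x))"
      using hx dbl[of "snd (\<phi> x)"] by (metis add_right_cancel)
    have hy': "scv (- fst (\<phi> y)) u = scv (1/2) (snd (\<phi> y))"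
      using hy by (simp add: neg_eq_iff_add_eq_0)
    have px: "snd (\<phi> x) = scv (fst (\<phi> x)) w"
      using arg_cong[OF hx', of "scv 2"] two by (simp add: w_def mult.commute)
    have py: "snd (\<phi> y) = scv (- fst (\<phi> y)) w"
      using arg_cong[OF hy', of "scv 2"] two by (simp add: w_def mult.commute)
    have "snd (\<phi> p) = scv (fst (\<phi> x) - fst (\<phi> y)) w"
      by (simp add: p_eq add px py scale_left_diff_distrib)
    then obtain c where pp: "snd (\<phi> p) = scv c w" by blast
    have m0: "fst (\<phi> m) = 0" and mB: "B (snd (\<phi> m)) w = 0"
      using m u0 two by (auto simp: Aminus_def eig al w_def B_simps)
    have "neg_refl w (snd (\<phi> p) + snd (\<phi> m)) = snd (\<phi> p) - snd (\<phi> m)"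
      by (simp add: neg_refl_def pp B_simps mB w1 scale_two flip: scale_scale)
    then show "p - m = lift_id_prod \<phi> (neg_refl w) (p + m)"
      by (simp add: eq_lift_id_prod_iff[OF bij] diff add m0)
  qed
  then show thesis using that w1 by blast
qed

section \<open>The affine Weyl group of type \<open>D\<^sub>4\<close>\<close>

text \<open>These are the monomial matrices. Coordinate \<open>i\<close> of the result is read at
  position \<open>p i\<close>, so composing maps composes permutations in the opposite
  order.\<close>

definition sperm :: "(4 \<Rightarrow> 4) \<Rightarrow> (4 \<Rightarrow> real) \<Rightarrow> real^4 \<Rightarrow> real^4" where
  "sperm p s x = (\<chi> i. s i * x $ p i)"

definition aff :: "(4 \<Rightarrow> 4) \<Rightarrow> (4 \<Rightarrow> real) \<Rightarrow> real^4 \<Rightarrow> real^4 \<Rightarrow> real^4" where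
  "aff p s l x = sperm p s x + l"

lemma sperm_comp: "sperm p s \<circ> sperm p' s' = sperm (p' \<circ> p) (\<lambda>i. s i * s' (p i))"
  by (simp add: sperm_def fun_eq_iff vec_eq_iff)

lemma sperm_add: "sperm p s (x + y) = sperm p s x + sperm p s y"
  by (simp add: sperm_def vec_eq_iff algebra_simps)

lemma sperm_scale: "sperm p s (c *\<^sub>R x) = c *\<^sub>R sperm p s x"
  by (simp add: sperm_def vec_eq_iff)

lemma sperm_id: "sperm id (\<lambda>_. 1) = id"
  by (simp add: sperm_def fun_eq_iff vec_eq_iff)

lemma aff_comp: "aff p s l \<circ> aff p' s' l' = aff (p' \<circ> p) (\<lambda>i. s i * s' (p i)) (sperm p s l' + l)"
  by (simp add: aff_def sperm_add fun_eq_iff flip: sperm_comp)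

text \<open>Evaluation at 0, at unit vectors and at the all-ones vector recovers translation,
  permutation and signs in turn.\<close>

lemma aff_eqD:
  assumes eq: "aff p s l = aff p' s' l'" and s: "\<And>i. s i \<noteq> 0"
  shows "p = p'" "s = s'" "l = l'"
proof -
  have "aff p s l 0 = aff p' s' l' 0" by (simp add: eq)
  then show l: "l = l'" by (simp add: aff_def sperm_def vec_eq_iff)
  have *: "s i * x $ p i = s' i * x $ p' i" for i x
    using fun_cong[OF eq, of x] by (simp add: l aff_def sperm_def vec_eq_iff)
  have p: "p i = p' i" for i
    using *[of i "axis (p i) 1"] s[of i] by (auto simp: axis_def split: if_splits)
  then show "p = p'" by auto
  show "s = s'" using *[of _ "\<chi> _. 1"] by auto
qed

text \<open>The factor \<open>- (s * t)\<close> is 1 for roots of opposite signs, giving a plain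
  transposition, and -1 for equal signs, where both swapped coordinates are also negated.\<close>

lemma reflection_sperm:
  assumes "i \<noteq> j" "s \<in> {1,-1}" "t \<in> {1,-1}"
  shows "reflection (s *\<^sub>R axis i 1 + t *\<^sub>R axis j 1) =
    sperm (Transposition.transpose i j) (\<lambda>a. if a = i \<or> a = j then - (s * t) else 1)"
proof
  fix x :: "real^4"
  let ?a = "s *\<^sub>R axis i 1 + t *\<^sub>R axis j 1 :: real^4"
  have "?a \<bullet> ?a = 2" using assms
    by (auto simp: inner_add_left inner_add_right inner_axis_axis)
  moreover have "x \<bullet> ?a = s * x $ i + t * x $ j"
    by (simp add: inner_add_right inner_axis)
  ultimately have r: "reflection ?a x = x - (s * x $ i + t * x $ j) *\<^sub>R ?a"
    by (simp add: reflection_def)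
  show "reflection ?a x = sperm (Transposition.transpose i j) (\<lambda>a. if a = i \<or> a = j then - (s * t) else 1) x"
    unfolding r using assms by (auto simp: vec_eq_iff sperm_def axis_def Transposition.transpose_def algebra_simps)
qed

lemma D4_rootsE:
  assumes "\<alpha> \<in> D4_roots"
  obtains i j s t where "i \<noteq> j" "s \<in> {1,-1}" "t \<in> {1,-1}" "\<alpha> = s *\<^sub>R axis i 1 + t *\<^sub>R axis j 1"
  using assms unfolding D4_roots_def by blast

lemma bij_reflection: "\<alpha> \<in> D4_roots \<Longrightarrow> bij (reflection \<alpha>)"
proof (rule involuntory_imp_bij)
  fix x assume "\<alpha> \<in> D4_roots"
  then obtain i j s t where *: "i \<noteq> j" "s \<in> {1,-1}" "t \<in> {1,-1}" and "\<alpha> = s *\<^sub>R axis i 1 + t *\<^sub>R axis j 1"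
    by (elim D4_rootsE)
  then have r: "reflection \<alpha> =
    sperm (Transposition.transpose i j) (\<lambda>a. if a = i \<or> a = j then - (s * t) else 1)"
    using reflection_sperm by blast
  have "(reflection \<alpha> \<circ> reflection \<alpha>) x = sperm id (\<lambda>_. 1) x"
    unfolding r sperm_comp
    by (rule arg_cong2[where f="\<lambda>p s. sperm p s x"]) (use * in \<open>auto simp: fun_eq_iff Transposition.transpose_def\<close>)
  then show "reflection \<alpha> (reflection \<alpha> x) = x" by (simp add: sperm_id)
qed

section \<open>Closure properties of the Weyl group of type D4\<close>

lemma reflection_in_Weyl: "\<alpha> \<in> D4_roots \<Longrightarrow> reflection \<alpha> \<in> Weyl_D4"
  unfolding Weyl_D4_def by (rule generate.incl) simp

lemma subgroup_Weyl_D4: "subgroup Weyl_D4 (BijGroup UNIV)"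
  unfolding Weyl_D4_def
  by (rule group.generate_is_subgroup[OF group_BijGroup]) (auto simp: bij_group_carrier bij_reflection)

lemma bij_Weyl: "w \<in> Weyl_D4 \<Longrightarrow> bij w"
  using subgroup.mem_carrier[OF subgroup_Weyl_D4] by (auto simp: bij_group_carrier)

lemma Weyl_comp: "w \<in> Weyl_D4 \<Longrightarrow> w' \<in> Weyl_D4 \<Longrightarrow> w \<circ> w' \<in> Weyl_D4"
  using subgroup.m_closed[OF subgroup_Weyl_D4] by (metis bij_group_mult bij_Weyl)

lemma Weyl_inv: "w \<in> Weyl_D4 \<Longrightarrow> Hilbert_Choice.inv w \<in> Weyl_D4"
  using subgroup.m_inv_closed[OF subgroup_Weyl_D4] by (metis bij_group_inv bij_Weyl)

lemma Weyl_id: "id \<in> Weyl_D4"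
  using subgroup.one_closed[OF subgroup_Weyl_D4] by (simp add: bij_group_one)

section \<open>The D4 root lattice and its invariance under the Weyl group\<close>

lemma lattice_int: "x \<in> D4_lattice \<Longrightarrow> x $ a \<in> \<int>"
  by (induction rule: D4_lattice.induct) (auto simp: D4_roots_def axis_def)

lemma lattice_add_nat_root:
  assumes "\<alpha> \<in> D4_roots" "x \<in> D4_lattice"
  shows "x + real n *\<^sub>R \<alpha> \<in> D4_lattice" "x - real n *\<^sub>R \<alpha> \<in> D4_lattice"
proof (induction n)
  case (Suc n)
  { case 1 show ?case using D4_lattice.root[OF assms(1) Suc(1)] by (simp add: algebra_simps) }
  { case 2 show ?case using D4_lattice.neg[OF assms(1) Suc(2)] by (simp add: algebra_simps) }
qed (use assms in auto)

lemma lattice_diff_int_root: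
  assumes "\<alpha> \<in> D4_roots" "x \<in> D4_lattice" "c \<in> \<int>"
  shows "x - c *\<^sub>R \<alpha> \<in> D4_lattice"
proof -
  obtain n where c: "c = real n \<or> c = - real n"
    using assms(3) by (metis Ints_cases int_cases2 of_int_minus of_int_of_nat_eq)
  then show ?thesis using lattice_add_nat_root[OF assms(1,2), of n] by auto
qed

lemma lattice_add: "x \<in> D4_lattice \<Longrightarrow> y \<in> D4_lattice \<Longrightarrow> x + y \<in> D4_lattice"
proof (induction x rule: D4_lattice.induct)
  case (root \<alpha> x)
  then show ?case using D4_lattice.root[of \<alpha> "x + y"] by (simp add: algebra_simps)
next
  case (neg \<alpha> x)
  then show ?case using D4_lattice.neg[of \<alpha> "x + y"] by (simp add: algebra_simps)
qed simp

lemma lattice_minus: "x \<in> D4_lattice \<Longrightarrow> - x \<in> D4_lattice"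
proof (induction x rule: D4_lattice.induct)
  case (root \<alpha> x)
  then show ?case using D4_lattice.neg[of \<alpha> "-x"] by (simp add: minus_diff_commute)
next
  case (neg \<alpha> x)
  then show ?case using D4_lattice.root[of \<alpha> "-x"] by (simp add: algebra_simps)
qed (simp add: D4_lattice.zero)

text \<open>Roots have square length 2, so the reflection subtracts the root
  \<open>x \<bullet> \<alpha>\<close> times, and this number is an integer.\<close>

lemma reflection_lattice:
  assumes "\<alpha> \<in> D4_roots" "x \<in> D4_lattice"
  shows "reflection \<alpha> x \<in> D4_lattice"
proof -
  obtain i j s t where *: "i \<noteq> j" "s \<in> {1,-1}" "t \<in> {1,-1}" and a: "\<alpha> = s *\<^sub>R axis i 1 + t *\<^sub>R axis j 1"
    using assms(1) by (elim D4_rootsE)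
  have "\<alpha> \<bullet> \<alpha> = 2" using *
    by (auto simp: a inner_add_left inner_add_right inner_axis_axis)
  moreover have "x \<bullet> \<alpha> = s * x $ i + t * x $ j"
    by (simp add: a inner_add_right inner_axis)
  then have "x \<bullet> \<alpha> \<in> \<int>" using * lattice_int[OF assms(2)] by auto
  ultimately show ?thesis unfolding reflection_def
    using lattice_diff_int_root[OF assms, of "x \<bullet> \<alpha>"] by simp
qed

text \<open>Both properties hold for reflections and pass to products. Reflections are their own
  inverses, which disposes of inverses of generators.\<close>

lemma Weyl_structure:
  assumes "w \<in> Weyl_D4"
  shows "(\<exists>p s. bij p \<and> (\<forall>i. s i \<in> {1,-1}) \<and> w = sperm p s) \<and> w ` D4_lattice \<subseteq> D4_lattice"
proof -
  have refl: "(\<exists>p s. bij p \<and> (\<forall>i. s i \<in> {1,-1}) \<and> reflection \<alpha> = sperm p s) \<and>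
      reflection \<alpha> ` D4_lattice \<subseteq> D4_lattice" if "\<alpha> \<in> D4_roots" for \<alpha>
  proof -
    obtain i j s t where *: "i \<noteq> j" "s \<in> {1,-1}" "t \<in> {1,-1}" and a: "\<alpha> = s *\<^sub>R axis i 1 + t *\<^sub>R axis j 1"
      using \<open>\<alpha> \<in> D4_roots\<close> by (elim D4_rootsE)
    show ?thesis using reflection_sperm[OF *] * reflection_lattice[OF that]
      by (intro conjI exI[of _ "Transposition.transpose i j"] exI[of _ "\<lambda>a. if a = i \<or> a = j then - (s * t) else 1"])
         (auto simp: a)
  qed
  have refl_inv: "inv\<^bsub>BijGroup UNIV\<^esub> (reflection \<alpha>) = reflection \<alpha>" if "\<alpha> \<in> D4_roots" for \<alpha>
  proof -
    obtain i j s t where *: "i \<noteq> j" "s \<in> {1,-1}" "t \<in> {1,-1}" and a: "\<alpha> = s *\<^sub>R axis i 1 + t *\<^sub>R axis j 1"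
      using \<open>\<alpha> \<in> D4_roots\<close> by (elim D4_rootsE)
    have "reflection \<alpha> \<circ> reflection \<alpha> = sperm id (\<lambda>_. 1)"
      unfolding a reflection_sperm[OF *] sperm_comp
      by (rule arg_cong2[where f=sperm]) (use * in \<open>auto simp: fun_eq_iff Transposition.transpose_def\<close>)
    then show ?thesis using bij_reflection[OF that] by (simp add: bij_group_inv inv_unique_comp sperm_id)
  qed
  show ?thesis using assms unfolding Weyl_D4_def
  proof induction
    case one
    have "\<exists>p s. bij p \<and> (\<forall>i. s i \<in> {1,-1}) \<and> id = sperm p s"
      using sperm_id bij_id by (metis insertI1)
    then show ?case unfolding bij_group_one by (simp add: id_def)
  next
    case (incl h) then show ?case using refl by auto
  next
    case (inv h) then show ?case using refl refl_inv by (metis imageE)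
  next
    case (eng h1 h2)
    have "h1 \<otimes>\<^bsub>BijGroup UNIV\<^esub> h2 = h1 \<circ> h2"
      using eng.hyps bij_Weyl unfolding Weyl_D4_def by (intro bij_group_mult) auto
    moreover obtain p s p' s' where ps: "bij p" "\<forall>i. s i \<in> {1,-1}" "h1 = sperm p s"
      "bij p'" "\<forall>i. s' i \<in> {1,-1}" "h2 = sperm p' s'"
      using eng.IH by blast
    have "s i * s' (p i) \<in> {1,-1}" for i
      using spec[OF ps(2), of i] spec[OF ps(5), of "p i"] by auto
    then have "\<exists>p s. bij p \<and> (\<forall>i. s i \<in> {1,-1}) \<and> h1 \<circ> h2 = sperm p s"
      unfolding ps(3,6) sperm_comp using bij_comp[OF ps(1,4)]
      by (intro exI[of _ "p' \<circ> p"] exI[of _ "\<lambda>i. s i * s' (p i)"] conjI) auto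
    moreover have "(h1 \<circ> h2) ` D4_lattice \<subseteq> D4_lattice" using eng.IH by auto
    ultimately show ?case by (simp add: comp_def)
  qed
qed

section \<open>The affine Weyl group and its translations by twice the lattice\<close>

abbreviation Waff :: "(real^4 \<Rightarrow> real^4) set" where "Waff \<equiv> carrier Weyl_aff_D4"

lemma Waff_def: "Waff = {(\<lambda>x. w x + l) | w l. w \<in> Weyl_D4 \<and> l \<in> D4_lattice}"
  by (simp add: Weyl_aff_D4_def)

lemma WaffE:
  assumes "f \<in> Waff"
  obtains p s l where "f = aff p s l" "bij p" "\<And>i. s i \<in> {1,-1}" "l \<in> D4_lattice" "sperm p s \<in> Weyl_D4"
proof -
  obtain w l where f: "f = (\<lambda>x. w x + l)" and w: "w \<in> Weyl_D4" and l: "l \<in> D4_lattice"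
    using assms unfolding Waff_def by blast
  obtain p s where "bij p" "\<forall>i. s i \<in> {1,-1}" "w = sperm p s"
    using Weyl_structure[OF w] by blast
  then show thesis using that[of p s l] f l w by (simp add: aff_def[abs_def])
qed

lemma aff_in_Waff: "sperm p s \<in> Weyl_D4 \<Longrightarrow> l \<in> D4_lattice \<Longrightarrow> aff p s l \<in> Waff"
  unfolding Waff_def aff_def by blast

lemma lattice_sperm: "sperm p s \<in> Weyl_D4 \<Longrightarrow> l \<in> D4_lattice \<Longrightarrow> sperm p s l \<in> D4_lattice"
  using Weyl_structure by blast

lemma bij_Waff: "f \<in> Waff \<Longrightarrow> bij f"
proof -
  assume "f \<in> Waff"
  then obtain w l where f: "f = (\<lambda>x. x + l) \<circ> w" and w: "w \<in> Weyl_D4"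
    unfolding Waff_def by (auto simp: fun_eq_iff)
  have "bij (\<lambda>x::real^4. x + l)" by (rule o_bij[of "\<lambda>x. x - l"]) (auto simp: fun_eq_iff)
  then show "bij f" unfolding f using bij_Weyl[OF w] by (intro bij_comp)
qed

lemma Waff_comp: "f \<in> Waff \<Longrightarrow> g \<in> Waff \<Longrightarrow> f \<circ> g \<in> Waff"
  by (elim WaffE) (auto simp: aff_comp intro!: aff_in_Waff lattice_add lattice_sperm
      simp flip: sperm_comp intro: Weyl_comp)

lemma aff_id: "aff id (\<lambda>_. 1) 0 = id"
  by (simp add: fun_eq_iff aff_def sperm_id)

lemma id_Waff: "id \<in> Waff"
  unfolding aff_id[symmetric] by (rule aff_in_Waff) (simp_all add: sperm_id Weyl_id D4_lattice.zero)

lemma Waff_inv: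
  assumes "f \<in> Waff"
  shows "Hilbert_Choice.inv f \<in> Waff"
proof -
  obtain p s l where f: "f = aff p s l" "l \<in> D4_lattice" "sperm p s \<in> Weyl_D4"
    using assms by (elim WaffE)
  let ?w = "sperm p s" and ?v = "Hilbert_Choice.inv (sperm p s)"
  have v: "?v \<in> Weyl_D4" using f Weyl_inv by blast
  then obtain p' s' where v_eq: "?v = sperm p' s'" using Weyl_structure by blast
  have b: "bij ?w" using bij_Weyl f by blast
  have wv: "?w (?v x) = x" "?v (?w x) = x" for x
    using b by (simp_all add: bij_is_inj bij_is_surj surj_f_inv_f)
  \<comment> \<open>Solving \<open>y = w x + l\<close> for \<open>x\<close> applies the inverse of
    \<open>w\<close> to \<open>y - l\<close>.\<close>
  have "Hilbert_Choice.inv f = aff p' s' (- ?v l)"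
  proof (rule inv_unique_comp)
    show "f \<circ> aff p' s' (- ?v l) = id"
      using wv by (auto simp: fun_eq_iff f aff_def sperm_add v_eq[symmetric])
        (metis (no_types, opaque_lifting) add.left_inverse add.assoc add.right_neutral add_diff_cancel sperm_add)
    show "aff p' s' (- ?v l) \<circ> f = id"
      using wv by (auto simp: fun_eq_iff f aff_def sperm_add v_eq[symmetric])
        (metis add_diff_cancel sperm_add v_eq)
  qed
  moreover have "- ?v l \<in> D4_lattice" using Weyl_structure[OF v] f(2) lattice_minus by blast
  ultimately show ?thesis using aff_in_Waff[of p' s'] v v_eq by metis
qed

lemma subgroup_Waff: "subgroup Waff (BijGroup UNIV)"
proof
  show "Waff \<subseteq> carrier (BijGroup UNIV)" by (auto simp: bij_group_carrier bij_Waff)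
  show "\<one>\<^bsub>BijGroup UNIV\<^esub> \<in> Waff" by (simp add: bij_group_one id_Waff)
  show "x \<otimes>\<^bsub>BijGroup UNIV\<^esub> y \<in> Waff" if "x \<in> Waff" "y \<in> Waff" for x y
    using that by (simp add: bij_group_mult bij_Waff Waff_comp)
  show "inv\<^bsub>BijGroup UNIV\<^esub> x \<in> Waff" if "x \<in> Waff" for x
    using that by (simp add: bij_group_inv bij_Waff Waff_inv)
qed

lemma Weyl_aff_eq: "Weyl_aff_D4 = (BijGroup UNIV)\<lparr>carrier := Waff\<rparr>"
  by (simp add: Weyl_aff_D4_def)

lemma group_Weyl_aff: "group Weyl_aff_D4"
  by (subst Weyl_aff_eq) (rule subgroup.subgroup_is_group[OF subgroup_Waff group_BijGroup])

lemma Waff_mult: "f \<in> Waff \<Longrightarrow> g \<in> Waff \<Longrightarrow> f \<otimes>\<^bsub>Weyl_aff_D4\<^esub> g = f \<circ> g"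
  by (subst Weyl_aff_eq) (simp add: bij_group_mult bij_Waff)

lemma Waff_one: "\<one>\<^bsub>Weyl_aff_D4\<^esub> = id"
  by (subst Weyl_aff_eq) (simp add: bij_group_one)

lemma Waff_inv_eq: "f \<in> Waff \<Longrightarrow> inv\<^bsub>Weyl_aff_D4\<^esub> f = Hilbert_Choice.inv f"
  by (subst Weyl_aff_eq)
     (simp add: group.m_inv_consistent[OF group_BijGroup subgroup_Waff] bij_group_inv bij_Waff)

lemma two_Lambda_eq: "two_Lambda_transl = {aff id (\<lambda>_. 1) (2 *\<^sub>R l) | l. l \<in> D4_lattice}"
  by (simp add: two_Lambda_transl_def aff_def[abs_def] sperm_id)

text \<open>Conjugation by an element with linear part \<open>w\<close> turns the translation by
  \<open>2 m\<close> into the one by \<open>2 w(m)\<close>, and \<open>w\<close> preserves the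
  lattice.\<close>

lemma normal_two_Lambda: "two_Lambda_transl \<lhd> Weyl_aff_D4"
proof -
  interpret group Weyl_aff_D4 by (rule group_Weyl_aff)
  have sub: "two_Lambda_transl \<subseteq> Waff"
  proof -
    have "2 *\<^sub>R l \<in> D4_lattice" if "l \<in> D4_lattice" for l
      unfolding scaleR_2 using lattice_add that by blast
    then show ?thesis unfolding two_Lambda_eq by (auto intro!: aff_in_Waff simp: sperm_id Weyl_id)
  qed
  have tt: "(\<lambda>x. x + 2 *\<^sub>R l) \<circ> (\<lambda>x. x + 2 *\<^sub>R m) = (\<lambda>x. x + 2 *\<^sub>R (m + l))" for l m :: "real^4"
    by (simp add: fun_eq_iff algebra_simps)
  have "subgroup two_Lambda_transl Weyl_aff_D4"
  proof
    show "two_Lambda_transl \<subseteq> Waff" by (rule sub)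
    show "\<one>\<^bsub>Weyl_aff_D4\<^esub> \<in> two_Lambda_transl"
      by (auto simp: Waff_one two_Lambda_transl_def id_def intro!: exI[of _ 0] D4_lattice.zero)
    fix x assume x: "x \<in> two_Lambda_transl"
    then obtain l where l: "x = (\<lambda>x. x + 2 *\<^sub>R l)" "l \<in> D4_lattice" by (auto simp: two_Lambda_transl_def)
    have "Hilbert_Choice.inv x = (\<lambda>x. x + 2 *\<^sub>R (- l))"
      by (rule inv_unique_comp) (auto simp: l fun_eq_iff)
    moreover have "(\<lambda>x. x + 2 *\<^sub>R (- l)) \<in> two_Lambda_transl"
      unfolding two_Lambda_transl_def using lattice_minus[OF l(2)] by blast
    ultimately show "inv\<^bsub>Weyl_aff_D4\<^esub> x \<in> two_Lambda_transl"
      using Waff_inv_eq[OF subsetD[OF sub x]] by simp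
    fix y assume y: "y \<in> two_Lambda_transl"
    then obtain m where m: "y = (\<lambda>x. x + 2 *\<^sub>R m)" "m \<in> D4_lattice" by (auto simp: two_Lambda_transl_def)
    have "x \<circ> y \<in> two_Lambda_transl"
      unfolding l m tt using l m lattice_add by (auto simp: two_Lambda_transl_def)
    then show "x \<otimes>\<^bsub>Weyl_aff_D4\<^esub> y \<in> two_Lambda_transl"
      using x y sub by (simp add: Waff_mult subset_iff)
  qed
  then show ?thesis
  proof (rule normal_invI)
    fix x h assume x: "x \<in> Waff" and h: "h \<in> two_Lambda_transl"
    obtain p s l where f: "x = aff p s l" "l \<in> D4_lattice" "sperm p s \<in> Weyl_D4" using x by (elim WaffE)
    obtain m where m: "h = (\<lambda>x. x + 2 *\<^sub>R m)" "m \<in> D4_lattice" using h by (auto simp: two_Lambda_transl_def)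
    have k: "(\<lambda>y. y + 2 *\<^sub>R sperm p s m) \<in> two_Lambda_transl"
      using lattice_sperm[OF f(3) m(2)] by (auto simp: two_Lambda_transl_def)
    have "x \<circ> h = (\<lambda>y. y + 2 *\<^sub>R sperm p s m) \<circ> x"
      by (auto simp: fun_eq_iff f m aff_def sperm_add sperm_scale)
    then have "x \<otimes>\<^bsub>Weyl_aff_D4\<^esub> h = (\<lambda>y. y + 2 *\<^sub>R sperm p s m) \<otimes>\<^bsub>Weyl_aff_D4\<^esub> x"
      using x h k sub by (simp add: Waff_mult subset_iff)
    then show "x \<otimes>\<^bsub>Weyl_aff_D4\<^esub> h \<otimes>\<^bsub>Weyl_aff_D4\<^esub> inv\<^bsub>Weyl_aff_D4\<^esub> x \<in> two_Lambda_transl"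
      using inv_solve_right'[OF _ m_closed[OF x subsetD[OF sub h]] x, of "\<lambda>y. y + 2 *\<^sub>R sperm p s m"]
        subsetD[OF sub k] k by simp
  qed
qed

section \<open>Permutation parts of elements of the affine Weyl group\<close>

definition perm_part :: "(real^4 \<Rightarrow> real^4) \<Rightarrow> 4 \<Rightarrow> 4" where
  "perm_part f = (THE p. \<exists>s l. f = aff p s l \<and> (\<forall>i. s i \<in> {1,-1}))"

lemma perm_part_aff:
  assumes "\<And>i. s i \<in> {1,-1}"
  shows "perm_part (aff p s l) = p"
  unfolding perm_part_def
proof (rule the_equality)
  fix p' assume "\<exists>s' l'. aff p s l = aff p' s' l' \<and> (\<forall>i. s' i \<in> {1,-1})"
  then obtain s' l' where eq: "aff p s l = aff p' s' l'" by blast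
  have "s i \<noteq> 0" for i using assms[of i] by auto
  from aff_eqD(1)[OF eq this] show "p' = p" by simp
qed (use assms in blast)

text \<open>The order is reversed as in \<open>sperm_comp\<close>. Products of signs are signs, so
  the composite is again in the form that the definite description asks for.\<close>

lemma perm_part_comp:
  assumes "f \<in> Waff" "g \<in> Waff"
  shows "perm_part (f \<circ> g) = perm_part g \<circ> perm_part f"
proof -
  obtain p s l where f: "f = aff p s l" "\<And>i. s i \<in> {1,-1}"
    using WaffE[OF assms(1)] by metis
  obtain p' s' l' where g: "g = aff p' s' l'" "\<And>i. s' i \<in> {1,-1}"
    using WaffE[OF assms(2)] by metis
  have "s i * s' (p i) \<in> {1,-1}" for i using f(2)[of i] g(2)[of "p i"] by auto
  then show ?thesis
    unfolding f(1) g(1) aff_comp perm_part_aff[OF f(2)] perm_part_aff[OF g(2)] by (rule perm_part_aff)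
qed

lemma perm_part_id: "perm_part id = id"
  unfolding aff_id[symmetric] by (rule perm_part_aff) simp

lemma perm_part_inv:
  assumes "f \<in> Waff"
  shows "perm_part f \<circ> perm_part (Hilbert_Choice.inv f) = id"
  using perm_part_comp[OF Waff_inv[OF assms] assms] bij_Waff[OF assms]
  by (simp add: perm_part_id bij_is_inj inv_o_cancel)

section \<open>Transpositions and even sign changes in the Weyl group\<close>

lemma axis_in_D4_roots:
  assumes "i \<noteq> j"
  shows "axis i 1 + axis j 1 \<in> D4_roots" "axis i 1 - axis j 1 \<in> D4_roots"
proof -
  have "1 *\<^sub>R axis i 1 + 1 *\<^sub>R axis j 1 \<in> D4_roots" "1 *\<^sub>R axis i 1 + (-1) *\<^sub>R axis j 1 \<in> D4_roots"
    unfolding D4_roots_def using assms by blast+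
  then show "axis i 1 + axis j 1 \<in> D4_roots" "axis i 1 - axis j 1 \<in> D4_roots" by simp_all
qed

lemma transpose_in_Weyl:
  assumes "i \<noteq> j"
  shows "sperm (Transposition.transpose i j) (\<lambda>_. 1) \<in> Weyl_D4"
  using reflection_in_Weyl[OF axis_in_D4_roots(2)[OF assms]] reflection_sperm[OF assms, of 1 "-1"]
  by (simp cong: if_cong)

text \<open>This is the product of the reflections in the difference and in the sum of two unit
  vectors: the transpositions cancel and the signs remain.\<close>

lemma two_signs_in_Weyl:
  assumes "i \<noteq> k"
  shows "sperm id (\<lambda>a. if a = i \<or> a = k then -1 else 1) \<in> Weyl_D4"
proof -
  have "sperm (Transposition.transpose i k) (\<lambda>a. if a = i \<or> a = k then -1 else 1) \<in> Weyl_D4"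
    using reflection_in_Weyl[OF axis_in_D4_roots(1)[OF assms]] reflection_sperm[OF assms, of 1 1]
    by (simp cong: if_cong)
  from Weyl_comp[OF transpose_in_Weyl[OF assms] this] show ?thesis
    unfolding sperm_comp
    by (rule back_subst[of "\<lambda>f. f \<in> Weyl_D4"])
       (rule arg_cong2[of _ _ _ _ sperm]; auto simp: fun_eq_iff Transposition.transpose_def)
qed

text \<open>On four points these are exactly the elements of the Klein four-group.\<close>

definition preserves_pairings :: "('i \<Rightarrow> 'i) \<Rightarrow> bool" where
  "preserves_pairings p \<longleftrightarrow> bij p \<and> (\<forall>S. card S = 2 \<longrightarrow> p ` S = S \<or> p ` S = - S)"

lemma preserves_pairings_comp:
  assumes p: "preserves_pairings p" and q: "preserves_pairings q"
  shows "preserves_pairings (p \<circ> q)"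
proof -
  have "(p \<circ> q) ` S = S \<or> (p \<circ> q) ` S = - S" if S: "card S = 2" for S
  proof -
    have "p ` (- S) = - (p ` S)" using p by (simp add: preserves_pairings_def bij_image_Compl_eq)
    then show ?thesis using p q S unfolding preserves_pairings_def image_comp[symmetric]
      by (metis boolean_algebra_class.boolean_algebra.double_compl)
  qed
  then show ?thesis using p q by (auto simp: preserves_pairings_def bij_comp)
qed

lemma preserves_pairings_id: "preserves_pairings id"
  by (simp add: preserves_pairings_def)

text \<open>The image \<open>{j, k}\<close> of \<open>{i, k}\<close> shares only the point
  \<open>k\<close> with it, so it is neither that set nor its complement.\<close>

lemma transpose_not_preserves_pairings:
  assumes "i \<noteq> j" "k \<noteq> i" "k \<noteq> j"
  shows "\<not> preserves_pairings (Transposition.transpose i j)"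
proof
  assume "preserves_pairings (Transposition.transpose i j)"
  moreover have "card {i, k} = 2" using assms by auto
  ultimately have "Transposition.transpose i j ` {i, k} = {i, k} \<or> Transposition.transpose i j ` {i, k} = - {i, k}"
    unfolding preserves_pairings_def by blast
  moreover have "Transposition.transpose i j ` {i, k} = {j, k}" using assms by (auto simp: Transposition.transpose_def)
  ultimately show False using assms by auto
qed

text \<open>Some pair \<open>{a, b}\<close> is sent neither to itself nor to its complement. Then
  \<open>p\<close> fixes one of its points and swaps the other with a point outside; the fourth
  point is left fixed.\<close>

lemma involution_not_preserves_pairings:
  fixes p :: "4 \<Rightarrow> 4"
  assumes inv: "p \<circ> p = id" and np: "\<not> preserves_pairings p"
  obtains i j k l where "distinct [i, j, k, l]" "\<And>x. x = i \<or> x = j \<or> x = k \<or> x = l"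
    "p = Transposition.transpose i j"
proof -
  have pp: "p (p x) = x" for x using inv by (simp add: fun_eq_iff)
  have "bij p" using pp by (rule involuntory_imp_bij)
  then obtain S where "card S = 2" and nS: "p ` S \<noteq> S" "p ` S \<noteq> - S"
    using np unfolding preserves_pairings_def by blast
  then obtain a b where S: "S = {a, b}" "a \<noteq> b" by (auto simp: card_2_iff)
  have "card (- {a, b}) = 2" using S(2) by (simp add: Compl_eq_Diff_UNIV card_Diff_subset)
  then obtain c d where cd: "- {a, b} = {c, d}" "c \<noteq> d" by (auto simp: card_2_iff)
  have all: "x = a \<or> x = b \<or> x = c \<or> x = d" for x using cd by blast
  have dist: "distinct [a, b, c, d]" using S(2) cd by auto
  have im: "{p a, p b} \<noteq> {a, b}" "{p a, p b} \<noteq> {c, d}" using nS by (simp_all add: S cd)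
  have tr: "p = Transposition.transpose u v"
    if "p u = v" "p v = u" "p w = w" "p z = z" "\<And>x. x = u \<or> x = v \<or> x = w \<or> x = z" for u v w z
  proof
    fix x show "p x = Transposition.transpose u v x" using that(5)[of x] that(1-4) by (auto simp: Transposition.transpose_def)
  qed
  have inj: "p x = p y \<longleftrightarrow> x = y" for x y by (metis pp)
  have ab: "p a \<noteq> b" using im pp[of a] by (auto simp: insert_commute)
  have "p a = a \<or> p b = b"
  proof (rule ccontr)
    assume "\<not> (p a = a \<or> p b = b)"
    then have "p a = c \<or> p a = d" "p b = c \<or> p b = d" using all[of "p a"] all[of "p b"] ab pp[of b] by auto
    then show False using im(2) inj[of a b] S(2) by (auto simp: insert_commute)
  qed
  then consider "p a = a" "p b = c" | "p a = a" "p b = d" | "p b = b" "p a = c" | "p b = b" "p a = d"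
    using im(1) all[of "p a"] all[of "p b"] ab pp[of b] by fastforce
  then show thesis
  proof cases
    case 1
    then have "p c = b" "p d = d" using pp[of b] all[of "p d"] dist inj[of d a] inj[of d b] inj[of d c] inj[of d d] by auto
    then show thesis using that[of b c a d] tr[of b c a d] 1 all dist by auto
  next
    case 2
    then have "p d = b" "p c = c" using pp[of b] all[of "p c"] dist inj[of c a] inj[of c b] inj[of c c] inj[of c d] by auto
    then show thesis using that[of b d a c] tr[of b d a c] 2 all dist by auto
  next
    case 3
    then have "p c = a" "p d = d" using pp[of a] all[of "p d"] dist inj[of d a] inj[of d b] inj[of d c] inj[of d d] by auto
    then show thesis using that[of a c b d] tr[of a c b d] 3 all dist by auto
  next
    case 4
    then have "p d = a" "p c = c" using pp[of a] all[of "p c"] dist inj[of c a] inj[of c b] inj[of c c] inj[of c d] by auto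
    then show thesis using that[of a d b c] tr[of a d b c] 4 all dist by auto
  qed
qed

section \<open>Quotients of the affine Weyl group\<close>

text \<open>All central quotients are treated at once: \<open>q\<close> is onto, kills the
  translations by twice the lattice, and its kernel is central modulo them.\<close>

locale Weyl_aff_D4_quotient = group K for K (structure) +
  fixes q :: "(real^4 \<Rightarrow> real^4) \<Rightarrow> 'a"
  assumes q_hom: "q \<in> hom Weyl_aff_D4 K"
    and q_onto: "q ` Waff = carrier K"
    and q_two_Lambda: "x \<in> two_Lambda_transl \<Longrightarrow> q x = \<one>"
    and q_kernel: "x \<in> Waff \<Longrightarrow> q x = \<one> \<Longrightarrow> g \<in> Waff \<Longrightarrow>
      \<exists>n\<in>two_Lambda_transl. x \<otimes>\<^bsub>Weyl_aff_D4\<^esub> g = n \<otimes>\<^bsub>Weyl_aff_D4\<^esub> (g \<otimes>\<^bsub>Weyl_aff_D4\<^esub> x)"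
begin

lemma q_closed: "x \<in> Waff \<Longrightarrow> q x \<in> carrier K"
  using q_onto by blast

lemma q_comp: "x \<in> Waff \<Longrightarrow> y \<in> Waff \<Longrightarrow> q (x \<circ> y) = q x \<otimes> q y"
  using hom_mult[OF q_hom] by (simp add: Waff_mult)

lemma q_id: "q id = \<one>"
  using hom_one[OF q_hom group_Weyl_aff is_group] by (simp add: Waff_one)

lemma q_inv:
  assumes "x \<in> Waff"
  shows "q (Hilbert_Choice.inv x) = inv (q x)"
proof -
  have "Hilbert_Choice.inv x \<circ> x = id" using bij_Waff[OF assms] by (simp add: bij_is_inj)
  then have "q (Hilbert_Choice.inv x) \<otimes> q x = \<one>"
    using q_comp[OF Waff_inv[OF assms] assms] q_id by simp
  then show ?thesis using inv_equality q_closed Waff_inv assms by metis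
qed

text \<open>Centrality modulo \<open>two_Lambda_transl\<close> is tested against all transpositions:
  \<open>p\<close> commutes with them, and \<open>s\<close> and the parities in \<open>l\<close> are
  invariant under them.\<close>

lemma kernel_structure:
  assumes k: "aff p s l \<in> Waff" and s: "\<And>i. s i \<in> {1,-1}" and q1: "q (aff p s l) = \<one>"
  shows "p = id" "s a = s b" "\<exists>n::int. l $ a - l $ b = 2 * of_int n"
proof -
  have main: "Transposition.transpose a b \<circ> p = p \<circ> Transposition.transpose a b \<and> s a = s b \<and>
      (\<exists>n::int. l $ a - l $ b = 2 * of_int n)" if ab: "a \<noteq> b" for a b
  proof -
    let ?t = "Transposition.transpose a b"
    have g: "aff ?t (\<lambda>_. 1) 0 \<in> Waff"
      by (intro aff_in_Waff transpose_in_Weyl ab D4_lattice.zero)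
    obtain n where n: "n \<in> two_Lambda_transl"
      and eq: "aff p s l \<otimes>\<^bsub>Weyl_aff_D4\<^esub> aff ?t (\<lambda>_. 1) 0 =
         n \<otimes>\<^bsub>Weyl_aff_D4\<^esub> (aff ?t (\<lambda>_. 1) 0 \<otimes>\<^bsub>Weyl_aff_D4\<^esub> aff p s l)"
      using q_kernel[OF k q1 g] by blast
    obtain m where m: "n = aff id (\<lambda>_. 1) (2 *\<^sub>R m)" "m \<in> D4_lattice"
      using n by (auto simp: two_Lambda_eq)
    have nW: "n \<in> Waff" using n normal_imp_subgroup[OF normal_two_Lambda] subgroup.subset by blast
    have "aff p s l \<circ> aff ?t (\<lambda>_. 1) 0 = n \<circ> (aff ?t (\<lambda>_. 1) 0 \<circ> aff p s l)"
      using eq k g nW by (simp add: Waff_mult Waff_comp)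
    then have eq': "aff (?t \<circ> p) s (sperm p s 0 + l) =
        aff (p \<circ> ?t) (\<lambda>i. s (?t i)) (sperm id (\<lambda>_. 1) (sperm ?t (\<lambda>_. 1) l + 0) + 2 *\<^sub>R m)"
      unfolding m aff_comp by (simp add: comp_def)
    have "s i \<noteq> 0" for i using s[of i] by auto
    note D = aff_eqD[OF eq' this]
    have "s a = s b" using fun_cong[OF D(2), of a] by simp
    moreover have "l $ a = l $ b + 2 * m $ a"
      using arg_cong[OF D(3), of "\<lambda>v. v $ a"] by (simp add: sperm_def)
    moreover obtain c where "m $ a = of_int c" using lattice_int[OF m(2), of a] by (auto elim: Ints_cases)
    ultimately show ?thesis using D(1) by (auto intro!: exI[of _ c])
  qed
  show "p = id"
  proof
    fix x show "p x = id x"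
    proof (rule ccontr)
      assume "p x \<noteq> id x"
      then have ne: "p x \<noteq> x" by simp
      have "- {x, p x} \<noteq> {}"
      proof
        assume "- {x, p x} = {}"
        then have "card (UNIV :: 4 set) \<le> card {x, p x}" by (metis Compl_empty_eq double_complement order_refl)
        also have "\<dots> \<le> 2" by (rule card_insert_le_m1) auto
        finally show False by simp
      qed
      \<comment> \<open>The transposition of \<open>p x\<close> and \<open>c\<close> fixes
        \<open>x\<close> but moves \<open>p x\<close>, so it cannot commute with
        \<open>p\<close>.\<close>
      then obtain c where c: "c \<noteq> x" "c \<noteq> p x" by auto
      have "(Transposition.transpose (p x) c \<circ> p) x = (p \<circ> Transposition.transpose (p x) c) x"
        using main[of "p x" c] c by simp
      then show False using c ne by (simp add: Transposition.transpose_def)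
    qed
  qed
  show "s a = s b" using main[of a b] by (cases "a = b") auto
  show "\<exists>n::int. l $ a - l $ b = 2 * of_int n"
    using main[of a b] by (cases "a = b") (auto intro: exI[of _ 0])
qed

text \<open>Elements with equal images differ by a kernel element, whose linear part is 1 or -1 and
  whose translation has coordinates congruent modulo 2.\<close>

lemma q_eq_imp:
  assumes x: "x \<in> Waff" and y: "y \<in> Waff" and eq: "q x = q y"
  obtains c m where "c \<in> {1,-1}" "x = aff id (\<lambda>_. c) m \<circ> y"
    "\<And>a b. \<exists>n::int. m $ a - m $ b = 2 * of_int n"
proof -
  define k where "k = x \<circ> Hilbert_Choice.inv y"
  have kW: "k \<in> Waff" unfolding k_def using x y by (intro Waff_comp Waff_inv)
  have "q k = q x \<otimes> inv (q y)" unfolding k_def using x y by (simp add: q_comp q_inv Waff_inv)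
  then have k1: "q k = \<one>" using eq q_closed[OF y] by simp
  obtain p s m where k: "k = aff p s m" "\<And>i. s i \<in> {1,-1}"
    using WaffE[OF kW] by metis
  note S = kernel_structure[of p s m, OF kW[unfolded k(1)] k(2) k1[unfolded k(1)]]
  have "s = (\<lambda>_. s 1)" using S(2) by auto
  then have k': "k = aff id (\<lambda>_. s 1) m" using k(1) S(1) by metis
  have "x = k \<circ> y" unfolding k_def using bij_Waff[OF y] by (simp add: comp_assoc bij_is_inj inv_o_cancel)
  then show thesis using that[of "s 1" m] k(2) S(3) k' by metis
qed

text \<open>Kernel elements permute nothing, so permutation parts are well defined on
  \<open>K\<close>.\<close>

lemma q_eq_imp_perm_part:
  assumes x: "x \<in> Waff" and y: "y \<in> Waff" and eq: "q x = q y"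
  shows "perm_part x = perm_part y"
proof -
  obtain c m where c: "c \<in> {1,-1}" and xy: "x = aff id (\<lambda>_. c) m \<circ> y"
    using q_eq_imp[OF assms] by metis
  obtain p s l where y': "y = aff p s l" "\<And>i. s i \<in> {1,-1}"
    using WaffE[OF y] by metis
  have "c * s i \<in> {1,-1}" for i using c y'(2)[of i] by auto
  then show ?thesis unfolding xy y'(1) aff_comp by (subst (1 2) perm_part_aff) (use y'(2) in auto)
qed

text \<open>Squaring \<open>y\<close> removes the permutation, squaring again removes the signs, and
  squaring once more doubles the remaining lattice translation, which \<open>q\<close>
  kills.\<close>

lemma q_power_eight:
  assumes y: "y \<in> Waff" and inv: "perm_part y \<circ> perm_part y = id"
  shows "q y [^] (8::nat) = \<one>"
proof -
  obtain p s l where y': "y = aff p s l" "\<And>i. s i \<in> {1,-1}" using WaffE[OF y] by metis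
  have "p \<circ> p = id" using inv by (simp add: y'(1) perm_part_aff[OF y'(2)])
  define y2 where "y2 = y \<circ> y"
  define y4 where "y4 = y2 \<circ> y2"
  have W: "y2 \<in> Waff" "y4 \<in> Waff" unfolding y2_def y4_def using y by (auto intro!: Waff_comp)
  obtain m where y2: "y2 = aff id (\<lambda>i. s i * s (p i)) m"
    unfolding y2_def y'(1) aff_comp \<open>p \<circ> p = id\<close> by blast
  have sq: "s i * s (p i) * (s i * s (p i)) = 1" for i using y'(2)[of i] y'(2)[of "p i"] by auto
  obtain n where y4: "y4 = aff id (\<lambda>_. 1) n"
    unfolding y4_def y2 aff_comp by (simp add: sq)
  have nL: "n \<in> D4_lattice"
  proof -
    obtain p' s' l' where "y4 = aff p' s' l'" "l' \<in> D4_lattice" using W(2) by (elim WaffE)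
    then show ?thesis using aff_eqD(3)[of id "\<lambda>_. 1" n p' s' l'] y4 by simp
  qed
  have "y4 \<circ> y4 = aff id (\<lambda>_. 1) (2 *\<^sub>R n)"
    unfolding y4 aff_comp by (simp add: sperm_id scaleR_2)
  then have "y4 \<circ> y4 \<in> two_Lambda_transl" using nL unfolding two_Lambda_eq by blast
  then have "q y4 \<otimes> q y4 = \<one>" using q_two_Lambda q_comp[OF W(2) W(2)] by simp
  moreover have "q y4 = q y [^] (4::nat)"
    unfolding y4_def y2_def using y q_closed[OF y]
    by (simp add: q_comp Waff_comp numeral_eq_Suc m_assoc)
  ultimately show ?thesis using q_closed[OF y] by (simp add: nat_pow_mult)
qed

text \<open>If all generators preserved pairings, so would all of \<open>K\<close>, against the
  transposition of 1 and 2. A generator that does not is an involution, hence so is its permutation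
  part, which must then be a transposition.\<close>

lemma exists_transposition:
  assumes S: "S \<subseteq> carrier K" and gen: "generate K S = carrier K"
    and invol: "\<And>s. s \<in> S \<Longrightarrow> s \<otimes> s = \<one>"
  obtains g i j k l where "g \<in> Waff" "q g \<in> S" "distinct [i, j, k, l]"
    "\<And>x. x = i \<or> x = j \<or> x = k \<or> x = l" "perm_part g = Transposition.transpose i j"
proof -
  have "\<exists>g\<in>Waff. q g \<in> S \<and> \<not> preserves_pairings (perm_part g)"
  proof (rule ccontr)
    assume "\<not> ?thesis"
    then have S_pres: "preserves_pairings (perm_part g)" if "g \<in> Waff" "q g \<in> S" for g
      using that by blast
    have pres: "\<forall>g\<in>Waff. q g = h \<longrightarrow> preserves_pairings (perm_part g)" if "h \<in> generate K S" for h
      using that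
    proof induction
      case one
      then show ?case
        using q_eq_imp_perm_part[OF _ id_Waff] q_id perm_part_id preserves_pairings_id by metis
    next
      case (incl h) then show ?case using S_pres by blast
    next
      case (inv h)
      then have "inv h = h" using invol inv_equality S by blast
      then show ?case using S_pres inv by simp
    next
      case (eng h1 h2)
      have "h1 \<in> carrier K" "h2 \<in> carrier K" using eng.hyps gen by auto
      then obtain g1 g2 where g: "g1 \<in> Waff" "h1 = q g1" "g2 \<in> Waff" "h2 = q g2"
        using q_onto by blast
      show ?case
      proof (intro ballI impI)
        fix x assume x: "x \<in> Waff" "q x = h1 \<otimes> h2"
        have "perm_part x = perm_part (g1 \<circ> g2)"
          using x g by (intro q_eq_imp_perm_part Waff_comp) (simp_all add: q_comp)
        then show "preserves_pairings (perm_part x)"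
          using g eng.IH by (simp add: perm_part_comp preserves_pairings_comp)
      qed
    qed
    have W: "aff (Transposition.transpose 1 2) (\<lambda>_. 1) 0 \<in> Waff"
      by (intro aff_in_Waff transpose_in_Weyl D4_lattice.zero) simp
    have "preserves_pairings (perm_part (aff (Transposition.transpose 1 2) (\<lambda>_. 1) 0))"
      using pres[of "q (aff (Transposition.transpose 1 2) (\<lambda>_. 1) 0)"] W q_closed[OF W] gen by simp
    then have "preserves_pairings (Transposition.transpose 1 (2::4))"
      by (simp add: perm_part_aff)
    then show False using transpose_not_preserves_pairings[of 1 "2::4" 3] by simp
  qed
  then obtain g where g: "g \<in> Waff" "q g \<in> S" "\<not> preserves_pairings (perm_part g)" by blast
  have "q (g \<circ> g) = q id" using g invol by (simp add: q_comp q_id)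
  then have "perm_part g \<circ> perm_part g = id"
    using q_eq_imp_perm_part[OF Waff_comp[OF g(1) g(1)] id_Waff] g by (simp add: perm_part_comp perm_part_id)
  then show thesis by (rule involution_not_preserves_pairings[OF _ g(3)]) (rule that[OF g(1,2)])
qed

text \<open>The five elements are conjugates of \<open>d\<close> lying over \<open>(i j)\<close> or
  \<open>(k l)\<close>. Their pairwise products have order dividing 8, so the order condition makes
  them commute; the common noncommuting element is a conjugate of \<open>d\<close> over
  \<open>(i k)\<close>.\<close>

lemma five_commuting_conjugates:
  assumes S: "S \<subseteq> carrier K" and gen: "generate K S = carrier K"
    and invol: "\<And>s. s \<in> S \<Longrightarrow> s \<otimes> s = \<one>"
    and conj: "\<And>s h. s \<in> S \<Longrightarrow> h \<in> carrier K \<Longrightarrow> h \<otimes> s \<otimes> inv h \<in> S"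
    and order: "\<And>s t. s \<in> S \<Longrightarrow> t \<in> S \<Longrightarrow>
      (s \<otimes> t) [^] (2::nat) = \<one> \<or> (s \<otimes> t) [^] (3::nat) = \<one>"
  shows "\<exists>E e. E \<subseteq> S \<and> card E = 5 \<and> e \<in> S \<and> (\<forall>x\<in>E. \<forall>y\<in>E. x \<otimes> y = y \<otimes> x) \<and>
    (\<forall>x\<in>E. x \<otimes> e \<noteq> e \<otimes> x)"
proof -
  obtain g i j k l where g: "g \<in> Waff" "q g \<in> S" and dist: "distinct [i, j, k, l]"
    and all: "\<And>x. x = i \<or> x = j \<or> x = k \<or> x = l" and pg: "perm_part g = Transposition.transpose i j"
    by (rule exists_transposition[OF S gen invol]) auto
  have ne: "i \<noteq> j" "j \<noteq> i" "i \<noteq> k" "k \<noteq> i" "i \<noteq> l" "l \<noteq> i" "j \<noteq> k" "k \<noteq> j" "j \<noteq> l" "l \<noteq> j"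
    "k \<noteq> l" "l \<noteq> k"
    using dist by auto
  define d where "d = q g"
  have dS: "d \<in> S" and dK: "d \<in> carrier K" using g S by (auto simp: d_def)
  obtain p s v where g_eq: "g = aff p s v" "\<And>a. s a \<in> {1,-1}" using WaffE[OF g(1)] by metis
  have p: "p = Transposition.transpose i j" using pg unfolding g_eq(1) perm_part_aff[OF g_eq(2)] .
  \<comment> \<open>\<open>n\<close> exchanges the pairs \<open>{i, j}\<close> and
    \<open>{k, l}\<close>, while \<open>\<epsilon>\<close> and \<open>m\<close> are supported on one
    point of each. Each of the three thereby gives an element not centralising
    \<open>d\<close>.\<close>
  define n where "n = Transposition.transpose i k \<circ> Transposition.transpose j l"
  define \<epsilon> where "\<epsilon> a = (if a = i \<or> a = k then -1 else 1 :: real)" for a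
  define m :: "real^4" where "m = axis i 1 + axis k 1"
  have n_apply: "n i = k" "n k = i" "n j = l" "n l = j"
    by (auto simp: ne n_def Transposition.transpose_def)
  have p_apply: "p i = j" "p j = i" "p k = k" "p l = l"
    by (auto simp: ne p Transposition.transpose_def)
  have ext4: "f = f'" if "f i = f' i" "f j = f' j" "f k = f' k" "f l = f' l" for f f' :: "4 \<Rightarrow> 4"
  proof
    fix x show "f x = f' x" using all[of x] that by auto
  qed
  have nn: "n \<circ> n = id" by (rule ext4) (simp_all add: n_apply)
  have \<epsilon>_sign: "\<epsilon> a \<in> {1,-1}" for a by (simp add: \<epsilon>_def)

  have mL: "m \<in> D4_lattice"
    using D4_lattice.root[OF axis_in_D4_roots(1) D4_lattice.zero, of i k] ne by (simp add: m_def)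
  have eps_W: "aff id \<epsilon> w \<in> Waff" if "w \<in> D4_lattice" for w
    using that ne two_signs_in_Weyl[of i k] unfolding \<epsilon>_def[abs_def] by (intro aff_in_Waff) auto
  have trans_W: "aff id (\<lambda>_. 1) w \<in> Waff" if "w \<in> D4_lattice" for w
    using that by (intro aff_in_Waff) (simp_all add: sperm_id Weyl_id)
  have n_W: "aff n (\<lambda>_. 1) w \<in> Waff" if "w \<in> D4_lattice" for w
  proof (rule aff_in_Waff[OF _ that])
    have "sperm (Transposition.transpose j l) (\<lambda>_. 1) \<circ> sperm (Transposition.transpose i k) (\<lambda>_. 1) \<in> Weyl_D4"
      using ne by (intro Weyl_comp transpose_in_Weyl) auto
    then show "sperm n (\<lambda>_. 1) \<in> Weyl_D4" by (simp add: sperm_comp n_def)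
  qed

  text \<open>The three reasons for an element not to centralise \<open>d\<close>: its permutation part, its signs
    (modulo the central \<open>-1\<close>), or its translation part modulo \<open>2\<Lambda>\<^sup>*\<close>.\<close>
  have comm_imp: "\<exists>c\<in>{1,-1}. \<exists>u. p \<circ> pz = pz \<circ> p \<and> (\<forall>a. sz a * s (pz a) = c * (s a * sz (p a))) \<and>
      sperm pz sz v + z = c *\<^sub>R (sperm p s z + v) + u \<and> (\<forall>a b. \<exists>n::int. u $ a - u $ b = 2 * of_int n)"
    if zW: "aff pz sz z \<in> Waff" and sz: "\<And>a. sz a \<in> {1,-1}"
      and cm: "q (aff pz sz z) \<otimes> d = d \<otimes> q (aff pz sz z)" for pz sz z
  proof -
    have "q (aff pz sz z \<circ> g) = q (g \<circ> aff pz sz z)" using cm zW g(1) by (simp add: q_comp d_def)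
    then obtain c u where c: "c \<in> {1,-1}" and eq: "aff pz sz z \<circ> g = aff id (\<lambda>_. c) u \<circ> (g \<circ> aff pz sz z)"
      and u: "\<And>a b. \<exists>n::int. u $ a - u $ b = 2 * of_int n"
      using q_eq_imp[OF Waff_comp[OF zW g(1)] Waff_comp[OF g(1) zW]] by metis
    have nz: "sz a * s (pz a) \<noteq> 0" for a using sz[of a] g_eq(2)[of "pz a"] by auto
    have "sperm id (\<lambda>_. c) x = c *\<^sub>R x" for x by (simp add: sperm_def vec_eq_iff)
    then have eq': "aff (p \<circ> pz) (\<lambda>a. sz a * s (pz a)) (sperm pz sz v + z) =
        aff (pz \<circ> p) (\<lambda>a. c * (s a * sz (p a))) (c *\<^sub>R (sperm p s z + v) + u)"
      using eq unfolding g_eq(1) aff_comp by simp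
    note D = aff_eqD[OF eq' nz]
    show ?thesis using D(1,3) fun_cong[OF D(2)] c u by blast
  qed
  have ncomm_n: "q z \<otimes> d \<noteq> d \<otimes> q z" if zW: "z \<in> Waff" and "perm_part z = n" for z
  proof
    assume cm: "q z \<otimes> d = d \<otimes> q z"
    obtain pz sz lz where z: "z = aff pz sz lz" "\<And>a. sz a \<in> {1,-1}" using WaffE[OF zW] by metis
    have "pz = n" using that(2) unfolding z(1) perm_part_aff[OF z(2)] .
    then have "p \<circ> n = n \<circ> p" using comm_imp[of pz sz lz] z zW cm by auto
    then have "p (n i) = n (p i)" by (metis comp_apply)
    then show False by (simp add: ne n_apply p_apply)
  qed
  have ncomm_eps: "q (aff id \<epsilon> z) \<otimes> d \<noteq> d \<otimes> q (aff id \<epsilon> z)" if zW: "aff id \<epsilon> z \<in> Waff" for z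
  proof
    assume cm: "q (aff id \<epsilon> z) \<otimes> d = d \<otimes> q (aff id \<epsilon> z)"
    obtain c where c: "\<forall>a. \<epsilon> a * s (id a) = c * (s a * \<epsilon> (p a))"
      using comm_imp[OF zW \<epsilon>_sign cm] by blast
    have "s i \<noteq> 0" "s k \<noteq> 0" using g_eq(2)[of i] g_eq(2)[of k] by auto
    \<comment> \<open>At \<open>i\<close>, which \<open>p\<close> sends to \<open>j\<close>, the
      equation forces \<open>c = -1\<close>; at the fixed point \<open>k\<close> it forces
      \<open>c = 1\<close>.\<close>
    then show False using spec[OF c, of i] spec[OF c, of k] by (simp add: ne p_apply \<epsilon>_def)
  qed
  have ncomm_t: "q (aff id (\<lambda>_. 1) m) \<otimes> d \<noteq> d \<otimes> q (aff id (\<lambda>_. 1) m)"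
  proof
    assume cm: "q (aff id (\<lambda>_. 1) m) \<otimes> d = d \<otimes> q (aff id (\<lambda>_. 1) m)"
    have "(1::real) \<in> {1,-1}" by simp
    from comm_imp[OF trans_W[OF mL] this cm]
    obtain c u where c: "\<forall>a. 1 * s (id a) = c * (s a * 1)"
      and eq: "sperm id (\<lambda>_. 1) v + m = c *\<^sub>R (sperm p s m + v) + u"
      and u: "\<forall>a b. \<exists>n::int. u $ a - u $ b = 2 * of_int n"
      by blast
    have "s i \<noteq> 0" using g_eq(2)[of i] by auto
    then have "c = 1" using spec[OF c, of i] by simp
    then have "u $ a = m $ a - s a * m $ p a" for a
      using arg_cong[OF eq, of "\<lambda>w. w $ a"] by (simp add: sperm_id) (simp add: sperm_def)
    \<comment> \<open>Since \<open>m\<close> vanishes at \<open>j\<close> and \<open>l\<close>, the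
      unknown signs \<open>s\<close> drop out; an odd difference is what contradicts
      \<open>u\<close>.\<close>
    then have "u $ i - u $ l = 1" by (simp add: ne p_apply m_def axis_def)
    moreover obtain r :: int where "u $ i - u $ l = 2 * of_int r" using u by blast
    ultimately have "(1::real) = of_int (2 * r)" by simp
    then have "1 = 2 * r" by linarith
    then show False by presburger
  qed

  define C where "C x = q x \<otimes> d \<otimes> inv (q x)" for x
  have C_S: "C x \<in> S" if "x \<in> Waff" for x
    unfolding C_def using conj[OF dS q_closed[OF that]] .
  \<comment> \<open>Conjugates by \<open>y\<close> and by \<open>y \<circ> z\<close> agree only if
    \<open>q z\<close> centralises \<open>d\<close>; every distinctness claim below is reduced to
    this.\<close>
  have C_neq: "C (y \<circ> z) \<noteq> C y" if y: "y \<in> Waff" and z: "z \<in> Waff" and nc: "q z \<otimes> d \<noteq> d \<otimes> q z" for y z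
  proof
    assume "C (y \<circ> z) = C y"
    then have "q y \<otimes> (q z \<otimes> d \<otimes> inv (q z)) \<otimes> inv (q y) = q y \<otimes> d \<otimes> inv (q y)"
      using y z dK q_closed by (simp add: C_def q_comp inv_mult_group m_assoc)
    then have "q z \<otimes> d \<otimes> inv (q z) = d"
      using y z dK q_closed by (metis inv_closed l_cancel m_closed r_cancel)
    then show False using nc z dK q_closed by (metis inv_solve_right m_closed)
  qed
  have C_perm: "\<exists>y\<in>Waff. C x = q y \<and> perm_part y = perm_part (Hilbert_Choice.inv x) \<circ> p \<circ> perm_part x"
    if "x \<in> Waff" for x
    using that g(1) pg
    by (intro bexI[of _ "x \<circ> g \<circ> Hilbert_Choice.inv x"])
       (simp_all add: C_def d_def q_comp q_inv q_closed m_assoc Waff_comp Waff_inv perm_part_comp comp_assoc p)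
  have C_perm_n: "\<exists>y\<in>Waff. C x = q y \<and> (perm_part y = p \<or> perm_part y = Transposition.transpose k l)"
    if x: "x \<in> Waff" and n: "perm_part x = id \<or> perm_part x = n" for x
  proof -
    obtain y where y: "y \<in> Waff" "C x = q y" "perm_part y = perm_part (Hilbert_Choice.inv x) \<circ> p \<circ> perm_part x"
      using C_perm[OF x] by blast
    have px: "perm_part x \<circ> perm_part (Hilbert_Choice.inv x) = id" by (rule perm_part_inv[OF x])
    have "perm_part (Hilbert_Choice.inv x) = perm_part x"
      using n px nn by (metis comp_assoc comp_id id_comp)
    moreover have "n \<circ> p \<circ> n = Transposition.transpose k l"
      by (intro ext4) (simp_all add: ne n_apply p_apply Transposition.transpose_def)
    ultimately show ?thesis using y n by auto
  qed
  have C_comm: "C x \<otimes> C x' = C x' \<otimes> C x"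
    if x: "x \<in> Waff" "perm_part x = id \<or> perm_part x = n"
      and x': "x' \<in> Waff" "perm_part x' = id \<or> perm_part x' = n" for x x'
  proof -
    obtain y where y: "y \<in> Waff" "C x = q y" "perm_part y = p \<or> perm_part y = Transposition.transpose k l"
      using C_perm_n[OF x] by blast
    obtain y' where y': "y' \<in> Waff" "C x' = q y'"
      "perm_part y' = p \<or> perm_part y' = Transposition.transpose k l"
      using C_perm_n[OF x'] by blast
    \<comment> \<open>The two transpositions are equal or disjoint, so their product squares to the
      identity.\<close>
    have "perm_part (y \<circ> y') \<circ> perm_part (y \<circ> y') = id"
      using y(3) y'(3) unfolding perm_part_comp[OF y(1) y'(1)]
      by (intro ext4) (auto simp: ne p Transposition.transpose_def)
    then have e8: "(C x \<otimes> C x') [^] (8::nat) = \<one>"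
      using q_power_eight[OF Waff_comp[OF y(1) y'(1)]] y y' by (simp add: q_comp)
    have cS: "C x \<in> S" "C x' \<in> S" using C_S x x' by auto
    then have cK: "C x \<in> carrier K" "C x' \<in> carrier K" using S by auto
    let ?a = "C x \<otimes> C x'"
    have aK: "?a \<in> carrier K" using cK by simp
    have "?a [^] (2::nat) = \<one>"
    proof (rule ccontr)
      assume "?a [^] (2::nat) \<noteq> \<one>"
      then have "?a [^] (3::nat) = \<one>" using order[OF cS] by blast
      \<comment> \<open>Since 9 = 8 + 1, an element killed by both 3 and 8 is trivial.\<close>
      then have "?a [^] (3 * 3::nat) = \<one>" using nat_pow_pow[OF aK, of 3 3] by simp
      moreover have "?a [^] (3 * 3::nat) = ?a [^] (8::nat) \<otimes> ?a"
        using aK by (simp add: numeral_eq_Suc)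
      ultimately have "?a = \<one>" using e8 aK by simp
      then show False using \<open>?a [^] (2::nat) \<noteq> \<one>\<close> by simp
    qed
    then have "?a = inv ?a" using aK by (simp add: numeral_2_eq_2 inv_equality)
    also have "\<dots> = inv (C x') \<otimes> inv (C x)" using cK by (simp add: inv_mult_group)
    also have "\<dots> = C x' \<otimes> C x" using inv_equality[OF invol[OF cS(1)]] inv_equality[OF invol[OF cS(2)]] cK by simp
    finally show ?thesis .
  qed

  \<comment> \<open>Conjugation by this transposition moves \<open>d\<close> from
    \<open>(i j)\<close> to \<open>(i k)\<close>, which shares exactly one point with each of
    \<open>(i j)\<close> and \<open>(k l)\<close>.\<close>
  define r where "r = aff (Transposition.transpose j k) (\<lambda>_. 1) (0::real^4)"
  have rW: "r \<in> Waff" unfolding r_def using ne by (intro aff_in_Waff transpose_in_Weyl D4_lattice.zero) auto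
  have pr: "perm_part r = Transposition.transpose j k" unfolding r_def by (simp add: perm_part_aff)
  obtain e where e: "e \<in> Waff" "C r = q e" "perm_part e = perm_part (Hilbert_Choice.inv r) \<circ> p \<circ> perm_part r"
    using C_perm[OF rW] by blast
  have "perm_part (Hilbert_Choice.inv r) = perm_part r"
    using perm_part_inv[OF rW] unfolding pr by (metis comp_assoc comp_id id_comp transpose_comp_involutory)
  then have pe: "perm_part e = Transposition.transpose i k"
    unfolding e(3) pr by (intro ext4) (auto simp: ne p Transposition.transpose_def)
  have C_ncomm: "C x \<otimes> C r \<noteq> C r \<otimes> C x" if x: "x \<in> Waff" "perm_part x = id \<or> perm_part x = n" for x
  proof
    assume cm: "C x \<otimes> C r = C r \<otimes> C x"
    obtain y where y: "y \<in> Waff" "C x = q y" "perm_part y = p \<or> perm_part y = Transposition.transpose k l"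
      using C_perm_n[OF x] by blast
    have "q (y \<circ> e) = q (e \<circ> y)" using cm y e by (simp add: q_comp)
    then have "perm_part e \<circ> perm_part y = perm_part y \<circ> perm_part e"
      using q_eq_imp_perm_part[OF Waff_comp[OF y(1) e(1)] Waff_comp[OF e(1) y(1)]]
      by (simp add: perm_part_comp y(1) e(1))
    then have "perm_part e (perm_part y k) = perm_part y (perm_part e k)" by (metis comp_apply)
    then show False using y(3) by (auto simp: ne pe p Transposition.transpose_def)
  qed

  \<comment> \<open>With \<open>id\<close> these are the five conjugating elements;
    \<open>x4\<close> is \<open>x1 \<circ> x2\<close> written out.\<close>
  define x1 x2 x3 x4 where "x1 = aff id \<epsilon> 0" and "x2 = aff id (\<lambda>_. 1) m" and "x3 = aff n (\<lambda>_. 1) 0"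
    and "x4 = aff id \<epsilon> (sperm id \<epsilon> m)"
  have x4L: "sperm id \<epsilon> m \<in> D4_lattice"
    using ne two_signs_in_Weyl[of i k] mL unfolding \<epsilon>_def[abs_def] by (intro lattice_sperm) auto
  have W: "x1 \<in> Waff" "x2 \<in> Waff" "x3 \<in> Waff" "x4 \<in> Waff"
    unfolding x1_def x2_def x3_def x4_def
    by (intro eps_W trans_W n_W D4_lattice.zero mL x4L)+
  have P: "perm_part x1 = id" "perm_part x2 = id" "perm_part x3 = n" "perm_part x4 = id"
    unfolding x1_def x2_def x3_def x4_def by (rule perm_part_aff, use \<epsilon>_sign in simp)+
  have neq: "C x \<noteq> C y" if "x = y \<circ> z" "y \<in> Waff" "z \<in> Waff" "q z \<otimes> d \<noteq> d \<otimes> q z" for x y z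
    using C_neq that by simp
  have ncx: "q x1 \<otimes> d \<noteq> d \<otimes> q x1" "q x2 \<otimes> d \<noteq> d \<otimes> q x2" "q x3 \<otimes> d \<noteq> d \<otimes> q x3" "q x4 \<otimes> d \<noteq> d \<otimes> q x4"
    using ncomm_eps W ncomm_t ncomm_n[OF W(3)] P unfolding x1_def x2_def x4_def by auto
  have d0: "C x \<noteq> C id" if "x \<in> {x1, x2, x3, x4}" for x
    using that neq[of _ id, OF _ id_Waff] W ncx by (metis id_comp insertE singletonD)
  \<comment> \<open>The quotient of \<open>x3\<close> by any of the others still has permutation
    part \<open>n\<close>.\<close>
  have d3: "C x3 \<noteq> C x" if "x \<in> {x1, x2, x4}" for x
  proof (rule neq[of x3 x "Hilbert_Choice.inv x \<circ> x3"])
    have xW: "x \<in> Waff" and px: "perm_part x = id" using that W P by auto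
    show "x \<in> Waff" by (rule xW)
    show zW: "Hilbert_Choice.inv x \<circ> x3 \<in> Waff" using xW W by (intro Waff_comp Waff_inv)
    show "x3 = x \<circ> (Hilbert_Choice.inv x \<circ> x3)"
      using bij_Waff[OF xW] by (simp add: fun_eq_iff bij_is_surj surj_f_inv_f)
    have "perm_part (Hilbert_Choice.inv x) = id" using perm_part_inv[OF xW] px by simp
    then show "q (Hilbert_Choice.inv x \<circ> x3) \<otimes> d \<noteq> d \<otimes> q (Hilbert_Choice.inv x \<circ> x3)"
      by (intro ncomm_n[OF zW]) (simp add: perm_part_comp Waff_inv xW W P)
  qed
  have d41: "C x4 \<noteq> C x1"
    by (rule neq[OF _ W(1) W(2) ncx(2)]) (simp add: x1_def x2_def x4_def aff_comp)
  \<comment> \<open>Here and in \<open>d42\<close> the quotient by \<open>x2\<close> has sign part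
    \<open>\<epsilon>\<close>, so \<open>ncomm_eps\<close> applies whatever its translation
    is.\<close>
  have d12: "C x1 \<noteq> C x2"
  proof (rule neq[OF _ W(2), of x1 "aff id \<epsilon> (- m)"])
    show "x1 = x2 \<circ> aff id \<epsilon> (- m)" by (simp add: x1_def x2_def aff_comp sperm_id)
    show zW: "aff id \<epsilon> (- m) \<in> Waff" by (intro eps_W lattice_minus mL)
    show "q (aff id \<epsilon> (- m)) \<otimes> d \<noteq> d \<otimes> q (aff id \<epsilon> (- m))" by (rule ncomm_eps[OF zW])
  qed
  have d42: "C x4 \<noteq> C x2"
  proof (rule neq[OF _ W(2), of x4 "aff id \<epsilon> (sperm id \<epsilon> m + (- m))"])
    show "x4 = x2 \<circ> aff id \<epsilon> (sperm id \<epsilon> m + (- m))" by (simp add: x4_def x2_def aff_comp sperm_id)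
    show zW: "aff id \<epsilon> (sperm id \<epsilon> m + (- m)) \<in> Waff" by (intro eps_W lattice_add lattice_minus mL x4L)
    show "q (aff id \<epsilon> (sperm id \<epsilon> m + (- m))) \<otimes> d \<noteq> d \<otimes> q (aff id \<epsilon> (sperm id \<epsilon> m + (- m)))"
      by (rule ncomm_eps[OF zW])
  qed
  define E where "E = C ` {id, x1, x2, x3, x4}"
  have "distinct [C id, C x1, C x2, C x3, C x4]"
    using d0[of x1] d0[of x2] d0[of x3] d0[of x4] d3[of x1] d3[of x2] d3[of x4] d41 d12 d42 by auto
  then have "card (set [C id, C x1, C x2, C x3, C x4]) = 5" by (subst distinct_card) simp_all
  then have card: "card E = 5" by (simp add: E_def)
  have XW: "x \<in> Waff \<and> (perm_part x = id \<or> perm_part x = n)" if "x \<in> {id, x1, x2, x3, x4}" for x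
    using that W P id_Waff perm_part_id by auto
  have "E \<subseteq> S" "C r \<in> S" using XW C_S rW by (auto simp: E_def)
  moreover have "\<forall>x\<in>E. \<forall>y\<in>E. x \<otimes> y = y \<otimes> x" using XW C_comm unfolding E_def by blast
  moreover have "\<forall>x\<in>E. x \<otimes> C r \<noteq> C r \<otimes> x" using XW C_ncomm unfolding E_def by blast
  ultimately show ?thesis using card by blast
qed

end

lemma central_quotient_five_commuting:
  assumes K: "group K" and cq: "central_quotient_of K Weyl2_D4_aff"
    and S: "S \<subseteq> carrier K" and gen: "generate K S = carrier K"
    and invol: "\<And>s. s \<in> S \<Longrightarrow> s \<otimes>\<^bsub>K\<^esub> s = \<one>\<^bsub>K\<^esub>"
    and conj: "\<And>s h. s \<in> S \<Longrightarrow> h \<in> carrier K \<Longrightarrow> h \<otimes>\<^bsub>K\<^esub> s \<otimes>\<^bsub>K\<^esub> inv\<^bsub>K\<^esub> h \<in> S"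
    and order: "\<And>s t. s \<in> S \<Longrightarrow> t \<in> S \<Longrightarrow>
      (s \<otimes>\<^bsub>K\<^esub> t) [^]\<^bsub>K\<^esub> (2::nat) = \<one>\<^bsub>K\<^esub> \<or> (s \<otimes>\<^bsub>K\<^esub> t) [^]\<^bsub>K\<^esub> (3::nat) = \<one>\<^bsub>K\<^esub>"
  obtains E e where "E \<subseteq> S" "card E = 5" "e \<in> S"
    "\<And>x y. x \<in> E \<Longrightarrow> y \<in> E \<Longrightarrow> x \<otimes>\<^bsub>K\<^esub> y = y \<otimes>\<^bsub>K\<^esub> x" "\<And>x. x \<in> E \<Longrightarrow> x \<otimes>\<^bsub>K\<^esub> e \<noteq> e \<otimes>\<^bsub>K\<^esub> x"
proof -
  obtain Z where "subgroup Z Weyl2_D4_aff" "Z \<subseteq> grp_center Weyl2_D4_aff" "K \<cong> Weyl2_D4_aff Mod Z"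
    using cq by (auto simp: central_quotient_of_def)
  from central_quotient_hom[OF group_Weyl_aff normal_two_Lambda this[unfolded Weyl2_D4_aff_def] K]
  obtain q where "q \<in> hom Weyl_aff_D4 K" "q ` Waff = carrier K"
    "\<And>x. x \<in> two_Lambda_transl \<Longrightarrow> q x = \<one>\<^bsub>K\<^esub>"
    "\<And>x g. x \<in> Waff \<Longrightarrow> q x = \<one>\<^bsub>K\<^esub> \<Longrightarrow> g \<in> Waff \<Longrightarrow>
      \<exists>n\<in>two_Lambda_transl. x \<otimes>\<^bsub>Weyl_aff_D4\<^esub> g = n \<otimes>\<^bsub>Weyl_aff_D4\<^esub> (g \<otimes>\<^bsub>Weyl_aff_D4\<^esub> x)"
    by metis
  then interpret Weyl_aff_D4_quotient K q
    using K by (simp add: Weyl_aff_D4_quotient_def Weyl_aff_D4_quotient_axioms_def)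
  show thesis using five_commuting_conjugates[OF S gen invol conj order] that by metis
qed

section \<open>From the algebra to ADE-type\<close>

theorem theoremC:
  fixes sc :: "'k::field \<Rightarrow> 'a::ab_group_add \<Rightarrow> 'a"
    and mu :: "'a \<Rightarrow> 'a \<Rightarrow> 'a"
    and scv :: "'k \<Rightarrow> 'v::ab_group_add \<Rightarrow> 'v"
    and B :: "'v \<Rightarrow> 'v \<Rightarrow> 'k"
    and \<phi> :: "'a \<Rightarrow> 'k \<times> 'v"
    and Ax :: "'a set"
  assumes char: "(2::'k) \<noteq> 0" "(3::'k) \<noteq> 0"
    and axial: "axial_jordan_half sc mu"
    and clifford: "clifford_iso sc mu scv B \<phi>"
    and axes: "\<forall>a\<in>Ax. half_axis sc mu a"
    and closed: "closed_axes sc mu Ax"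
    and generates: "alg_gen sc mu Ax = UNIV"
    and three_tr: "three_transposition_algebra sc mu Ax"
    and conj: "\<exists>d\<in>Dset sc mu Ax.
                 Dset sc mu Ax = conj_class (gen_grp (Dset sc mu Ax)) d"
  shows "ADE_type (gen_grp (Dset sc mu Ax)) (Dset sc mu Ax)"
proof -
  define D where "D = Dset sc mu Ax"
  define G where "G = gen_grp D"
  interpret sym_bilinear scv B by (rule sym_bilinear_clifford[OF clifford])
  define L where "L w = lift_id_prod \<phi> (neg_refl w)" for w
  have bij\<phi>: "bij \<phi>" using clifford by (simp add: clifford_iso_def)
  have L_comp_eq: "L u \<circ> L v = L v' \<circ> L u' \<longleftrightarrow> neg_refl u \<circ> neg_refl v = neg_refl v' \<circ> neg_refl u'"
    for u v u' v'
    by (simp add: L_def lift_id_prod_comp[OF bij\<phi>] lift_id_prod_eq_iff[OF bij\<phi>])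
  have L_eq: "L u = L v \<longleftrightarrow> neg_refl u = neg_refl v" for u v
    by (simp add: L_def lift_id_prod_eq_iff[OF bij\<phi>])
  have L_conj: "L u \<circ> L v \<circ> L u = L (neg_refl u v)" if "B u u = 1" for u v
    using neg_refl_conj[OF that, of v] by (simp add: L_def lift_id_prod_comp[OF bij\<phi>])
  have L_invol: "L u \<circ> L u = id" if "B u u = 1" for u
  proof -
    have "neg_refl u \<circ> neg_refl u = id" using neg_refl_involution[OF that] by (simp add: fun_eq_iff)
    then show ?thesis by (simp add: L_def lift_id_prod_comp[OF bij\<phi>] lift_id_prod_id[OF bij\<phi>])
  qed
  have D_L: "\<exists>w. B w w = 1 \<and> s = L w" if "s \<in> D" for s
  proof -
    obtain a where "a \<in> Ax" "s = miyamoto sc mu a" "miyamoto sc mu a \<noteq> id"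
      using \<open>s \<in> D\<close> by (auto simp: D_def Dset_def)
    then show ?thesis
      using miyamoto_clifford[OF char(1) clifford, of a] axes unfolding L_def by metis
  qed
  have D_invol: "s \<circ> s = id" if "s \<in> D" for s using D_L[OF that] L_invol by metis
  have D_bij: "bij s" if "s \<in> D" for s using D_invol[OF that] by (rule o_bij[OF _ D_invol[OF that]])

  have sub: "subgroup (generate (BijGroup UNIV) D) (BijGroup UNIV)"
    by (rule group.generate_is_subgroup[OF group_BijGroup]) (auto simp: bij_group_carrier D_bij)
  have G_eq: "G = (BijGroup UNIV)\<lparr>carrier := generate (BijGroup UNIV) D\<rparr>"
    by (simp add: G_def gen_grp_def)
  interpret G: group G
    unfolding G_eq by (rule subgroup.subgroup_is_group[OF sub group_BijGroup])
  have G_bij: "bij g" if "g \<in> carrier G" for g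
    using that subgroup.mem_carrier[OF sub] by (simp add: G_eq bij_group_carrier)
  have G_mult: "g \<otimes>\<^bsub>G\<^esub> h = g \<circ> h" if "g \<in> carrier G" "h \<in> carrier G" for g h
    using bij_group_mult[OF G_bij[OF that(1)] G_bij[OF that(2)]] by (simp add: G_eq)
  have G_one: "\<one>\<^bsub>G\<^esub> = id" by (simp add: G_eq bij_group_one)
  have D_G: "s \<in> carrier G" if "s \<in> D" for s using that by (simp add: G_eq generate.incl)
  have D_conj: "g \<otimes>\<^bsub>G\<^esub> s \<otimes>\<^bsub>G\<^esub> inv\<^bsub>G\<^esub> g \<in> D" if s: "s \<in> D" and g: "g \<in> carrier G" for s g
  proof -
    obtain d where d: "d \<in> D" "D = conj_class G d" using conj by (auto simp: D_def G_def)
    then obtain h where h: "h \<in> carrier G" "s = h \<otimes>\<^bsub>G\<^esub> d \<otimes>\<^bsub>G\<^esub> inv\<^bsub>G\<^esub> h"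
      using s by (auto simp: conj_class_def)
    have "g \<otimes>\<^bsub>G\<^esub> s \<otimes>\<^bsub>G\<^esub> inv\<^bsub>G\<^esub> g = (g \<otimes>\<^bsub>G\<^esub> h) \<otimes>\<^bsub>G\<^esub> d \<otimes>\<^bsub>G\<^esub> inv\<^bsub>G\<^esub> (g \<otimes>\<^bsub>G\<^esub> h)"
      using g h D_G[OF d(1)] by (simp add: G.inv_mult_group G.m_assoc)
    then show ?thesis using d(2) g h(1) unfolding conj_class_def by blast
  qed
  have D_inv: "inv\<^bsub>G\<^esub> s = s" if "s \<in> D" for s
    using that D_G D_invol by (intro G.inv_equality) (simp_all add: G_mult G_one)
  have D_order: "(s \<otimes>\<^bsub>G\<^esub> t) [^]\<^bsub>G\<^esub> (2::nat) = \<one>\<^bsub>G\<^esub> \<or> (s \<otimes>\<^bsub>G\<^esub> t) [^]\<^bsub>G\<^esub> (3::nat) = \<one>\<^bsub>G\<^esub>"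
    if s: "s \<in> D" and t: "t \<in> D" for s t
  proof -
    have c: "s \<otimes>\<^bsub>G\<^esub> t \<in> carrier G" using s t D_G by simp
    have "G.ord (s \<otimes>\<^bsub>G\<^esub> t) \<in> {1,2,3}"
      using three_tr s t unfolding three_transposition_algebra_def D_def G_def by blast
    then show ?thesis unfolding G.pow_eq_id[OF c] by auto
  qed

  \<comment> \<open>Both unit vectors of each involution are included; closure under
    \<open>neg_refl\<close> then expresses that \<open>D\<close> is normal in
    \<open>G\<close>.\<close>
  define Phi where "Phi = {w. B w w = 1 \<and> L w \<in> D}"
  have Phi: "three_transposition_vectors scv B Phi"
  proof unfold_locales
    show "(2::'k) \<noteq> 0" "(3::'k) \<noteq> 0" by (fact char)+
    show "B w w = 1" if "w \<in> Phi" for w using that by (simp add: Phi_def)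
    show "- w \<in> Phi" if "w \<in> Phi" for w
      using that by (simp add: Phi_def B_simps L_def neg_refl_minus)
    fix w v assume w: "w \<in> Phi" and v: "v \<in> Phi"
    have lw: "L w \<in> D" "B w w = 1" and lv: "L v \<in> D" "B v v = 1" using w v by (auto simp: Phi_def)
    have gw: "L w \<in> carrier G" and gv: "L v \<in> carrier G" using lw lv D_G by auto
    have "L w \<circ> L v \<circ> L w \<in> D"
      using D_conj[OF lv(1) gw] gw gv by (simp add: D_inv[OF lw(1)] G_mult[symmetric])
    then show "neg_refl w v \<in> Phi"
      using L_conj[OF lw(2), of v] B_neg_refl[OF lw(2), of v v] lv by (simp add: Phi_def)
    have sq: "L w \<otimes>\<^bsub>G\<^esub> L w = \<one>\<^bsub>G\<^esub>" "L v \<otimes>\<^bsub>G\<^esub> L v = \<one>\<^bsub>G\<^esub>"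
      using L_invol lw lv gw gv by (simp_all add: G_mult G_one)
    from D_order[OF lw(1) lv(1)]
    show "neg_refl w \<circ> neg_refl v = neg_refl v \<circ> neg_refl w \<or>
      neg_refl w \<circ> neg_refl v \<circ> neg_refl w = neg_refl v \<circ> neg_refl w \<circ> neg_refl v"
    proof
      assume "(L w \<otimes>\<^bsub>G\<^esub> L v) [^]\<^bsub>G\<^esub> (2::nat) = \<one>\<^bsub>G\<^esub>"
      then have "(L w \<otimes>\<^bsub>G\<^esub> L v) \<otimes>\<^bsub>G\<^esub> (L w \<otimes>\<^bsub>G\<^esub> L v) = \<one>\<^bsub>G\<^esub>"
        using gw gv by (simp add: numeral_2_eq_2)
      then have "L w \<otimes>\<^bsub>G\<^esub> L v = inv\<^bsub>G\<^esub> (L w \<otimes>\<^bsub>G\<^esub> L v)" using gw gv G.inv_equality by simp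
      also have "\<dots> = L v \<otimes>\<^bsub>G\<^esub> L w"
        using gw gv by (simp add: G.inv_mult_group D_inv[OF lw(1)] D_inv[OF lv(1)])
      finally have "L w \<circ> L v = L v \<circ> L w" using gw gv by (simp add: G_mult)
      then show ?thesis by (simp add: L_comp_eq)
    next
      assume "(L w \<otimes>\<^bsub>G\<^esub> L v) [^]\<^bsub>G\<^esub> (3::nat) = \<one>\<^bsub>G\<^esub>"
      \<comment> \<open>The cube of a product \<open>a b\<close> regroups as
        \<open>(a b a)(b a b)\<close>, and both factors are their own inverses.\<close>
      then have "(L w \<otimes>\<^bsub>G\<^esub> L v \<otimes>\<^bsub>G\<^esub> L w) \<otimes>\<^bsub>G\<^esub> (L v \<otimes>\<^bsub>G\<^esub> L w \<otimes>\<^bsub>G\<^esub> L v) = \<one>\<^bsub>G\<^esub>"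
        using gw gv by (simp add: numeral_3_eq_3 G.m_assoc)
      then have "L w \<otimes>\<^bsub>G\<^esub> L v \<otimes>\<^bsub>G\<^esub> L w = inv\<^bsub>G\<^esub> (L v \<otimes>\<^bsub>G\<^esub> L w \<otimes>\<^bsub>G\<^esub> L v)"
        using gw gv G.inv_equality by simp
      also have "\<dots> = L v \<otimes>\<^bsub>G\<^esub> L w \<otimes>\<^bsub>G\<^esub> L v"
        using gw gv by (simp add: G.inv_mult_group D_inv[OF lw(1)] D_inv[OF lv(1)] G.m_assoc)
      finally have "L w \<circ> L v \<circ> L w = L v \<circ> L w \<circ> L v" using gw gv by (simp add: G_mult[symmetric])
      then show ?thesis
        by (simp add: L_def lift_id_prod_comp[OF bij\<phi>] lift_id_prod_eq_iff[OF bij\<phi>])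
    qed
  qed
  interpret Phi: three_transposition_vectors scv B Phi by (rule Phi)
  have D_Phi: "\<exists>w\<in>Phi. s = L w" if "s \<in> D" for s
    using D_L[OF that] that by (auto simp: Phi_def)
  have comm_iff: "s \<otimes>\<^bsub>G\<^esub> t = t \<otimes>\<^bsub>G\<^esub> s \<longleftrightarrow> neg_refl u \<circ> neg_refl v = neg_refl v \<circ> neg_refl u"
    if "s \<in> D" "t \<in> D" "s = L u" "t = L v" for s t u v
    using that D_G by (simp add: G_mult L_comp_eq)

  \<comment> \<open>Symplectic type\<close>
  have "symplectic_type G D"
    unfolding symplectic_type_def
  proof (intro ballI impI)
    fix d e f assume def: "d \<in> D" "e \<in> D" "f \<in> D"
      and iso: "G\<lparr>carrier := generate G {e, f}\<rparr> \<cong> sym_group 3"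
    obtain u v w where u: "u \<in> Phi" "d = L u" and v: "v \<in> Phi" "e = L v" and w: "w \<in> Phi" "f = L w"
      using D_Phi def by metis
    have efe: "e \<otimes>\<^bsub>G\<^esub> f \<otimes>\<^bsub>G\<^esub> e \<in> D" using D_conj[OF def(3) D_G[OF def(2)]] by (simp add: D_inv[OF def(2)])
    have efe': "e \<otimes>\<^bsub>G\<^esub> f \<otimes>\<^bsub>G\<^esub> e = L (neg_refl v w)"
      using L_conj[OF Phi.unit[OF v(1)], of w] def D_G by (simp add: v w G_mult[symmetric])
    have "e \<otimes>\<^bsub>G\<^esub> f \<noteq> f \<otimes>\<^bsub>G\<^esub> e"
      using generate_pair_iso_sym_group_3[OF G.is_group D_G[OF def(2)] D_G[OF def(3)] iso] .
    then have "neg_refl v \<circ> neg_refl w \<noteq> neg_refl w \<circ> neg_refl v"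
      using comm_iff[OF def(2,3) v(2) w(2)] by simp
    from Phi.commute_with_S3[OF u(1) v(1) w(1) this]
    show "d \<otimes>\<^bsub>G\<^esub> e = e \<otimes>\<^bsub>G\<^esub> d \<or> d \<otimes>\<^bsub>G\<^esub> f = f \<otimes>\<^bsub>G\<^esub> d \<or>
        d \<otimes>\<^bsub>G\<^esub> (e \<otimes>\<^bsub>G\<^esub> f \<otimes>\<^bsub>G\<^esub> e) = (e \<otimes>\<^bsub>G\<^esub> f \<otimes>\<^bsub>G\<^esub> e) \<otimes>\<^bsub>G\<^esub> d"
      unfolding comm_iff[OF def(1,2) u(2) v(2)] comm_iff[OF def(1,3) u(2) w(2)]
        comm_iff[OF def(1) efe u(2) efe'] .
  qed

  \<comment> \<open>Exclusion of central quotients of the group of affine type D4\<close>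
  moreover have False if H: "subgroup H G" and gen: "H = generate G (D \<inter> H)"
    and cq: "central_quotient_of (G\<lparr>carrier := H\<rparr>) Weyl2_D4_aff" for H
  proof -
    let ?K = "G\<lparr>carrier := H\<rparr>"
    have K: "group ?K" by (rule subgroup.subgroup_is_group[OF H G.is_group])
    have inv: "inv\<^bsub>?K\<^esub> h = inv\<^bsub>G\<^esub> h" if "h \<in> H" for h by (rule G.m_inv_consistent[OF H that])
    have pow: "x [^]\<^bsub>?K\<^esub> (n::nat) = x [^]\<^bsub>G\<^esub> n" for x n by (simp add: nat_pow_def)
    have HG: "h \<in> carrier G" if "h \<in> H" for h using subgroup.mem_carrier[OF H that] .
    obtain E b where E: "E \<subseteq> D \<inter> H" "card E = 5" and b: "b \<in> D \<inter> H"
      and comm: "\<And>x y. x \<in> E \<Longrightarrow> y \<in> E \<Longrightarrow> x \<otimes>\<^bsub>G\<^esub> y = y \<otimes>\<^bsub>G\<^esub> x"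
      and ncomm: "\<And>x. x \<in> E \<Longrightarrow> x \<otimes>\<^bsub>G\<^esub> b \<noteq> b \<otimes>\<^bsub>G\<^esub> x"
    proof (rule central_quotient_five_commuting[OF K cq, of "D \<inter> H"])
      show "D \<inter> H \<subseteq> carrier ?K" by simp
      show "generate ?K (D \<inter> H) = carrier ?K"
        using G.generate_consistent[OF _ H, of "D \<inter> H"] gen by simp
      show "s \<otimes>\<^bsub>?K\<^esub> s = \<one>\<^bsub>?K\<^esub>" if "s \<in> D \<inter> H" for s
        using that D_invol D_G by (simp add: G_mult G_one)
      \<comment> \<open>\<open>D\<close> is normal in \<open>G\<close>, so
        \<open>D \<inter> H\<close> is normal in \<open>H\<close>.\<close>
      show "h \<otimes>\<^bsub>?K\<^esub> s \<otimes>\<^bsub>?K\<^esub> inv\<^bsub>?K\<^esub> h \<in> D \<inter> H" if "s \<in> D \<inter> H" "h \<in> carrier ?K" for s h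
        using that D_conj[of s h] HG subgroup.m_closed[OF H] subgroup.m_inv_closed[OF H]
        by (simp add: inv)
      show "(s \<otimes>\<^bsub>?K\<^esub> t) [^]\<^bsub>?K\<^esub> (2::nat) = \<one>\<^bsub>?K\<^esub> \<or> (s \<otimes>\<^bsub>?K\<^esub> t) [^]\<^bsub>?K\<^esub> (3::nat) = \<one>\<^bsub>?K\<^esub>"
        if "s \<in> D \<inter> H" "t \<in> D \<inter> H" for s t
        using D_order[of s t] that unfolding pow by simp
    qed auto
    have "finite E" using E(2) by (simp add: card_ge_0_finite)
    then obtain h where h: "bij_betw h {1..5::nat} E"
      using ex_bij_betw_nat_finite_1[of E] E(2) by auto
    have hE: "h i \<in> E" if "i \<in> {1..5}" for i using h that by (auto simp: bij_betw_def)
    have hD: "h i \<in> D" if "i \<in> {1..5}" for i using hE[OF that] E(1) by auto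
    \<comment> \<open>An involution determines its vector only up to sign; either choice will do, as
      signs are normalised in \<open>no_five_commuting\<close>.\<close>
    define w where "w i = (SOME v. v \<in> Phi \<and> h i = L v)" for i
    have w: "w i \<in> Phi" "h i = L (w i)" if "i \<in> {1..5}" for i
      using someI_ex[of "\<lambda>v. v \<in> Phi \<and> h i = L v"] D_Phi[OF hD[OF that]] unfolding w_def by blast+
    obtain v where v: "v \<in> Phi" "b = L v" using D_Phi b by blast
    show False
    proof (rule Phi.no_five_commuting[OF v(1), of w])
      show "w i \<in> Phi" if "i \<in> {1..5}" for i using w that by blast
      show "neg_refl (w i) \<circ> neg_refl (w j) = neg_refl (w j) \<circ> neg_refl (w i)"
        if "i \<in> {1..5}" "j \<in> {1..5}" for i j
        using comm[OF hE[OF that(1)] hE[OF that(2)]]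
          comm_iff[OF hD[OF that(1)] hD[OF that(2)] w(2)[OF that(1)] w(2)[OF that(2)]] by simp
      show "neg_refl (w i) \<circ> neg_refl v \<noteq> neg_refl v \<circ> neg_refl (w i)" if "i \<in> {1..5}" for i
        using ncomm[OF hE[OF that]] comm_iff[OF hD[OF that] _ w(2)[OF that] v(2)] b by simp
      show "neg_refl (w i) \<noteq> neg_refl (w j)" if "i \<in> {1..5}" "j \<in> {1..5}" "i \<noteq> j" for i j
        using bij_betw_imp_inj_on[OF h] that w(2)[OF that(1)] w(2)[OF that(2)] L_eq
        by (metis inj_onD)
    qed
  qed
  ultimately show ?thesis unfolding ADE_type_def D_def G_def by blast
qed

end
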